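(* Let $\mathcal T=(\mathbb T,\mathcal V,\xi)$ be a topological theory with $\bot\neq k$ in $\mathcal V$ and $T1=1$. For each $\mathcal T$-category $X$, the $\mathcal T$-graph $(\mathcal V^X)^{\mathrm{op}}$ is a $\mathcal T$-category.
   Context: **Theory.** A topological theory $\mathcal T=(\mathbb T,\mathcal V,\xi)$ consists of a monad $\mathbb T=(T,e,m)$ on $\mathsf{Set}$, a commutative unital quantale $\mathcal V=(\mathcal V,\otimes,k)$ (complete lattice, commutative monoid, $\otimes$ preserves suprema in each variable; $x\otimes y\le z\iff x\le\hom(y,z)$) and a map $\xi:T\mathcal V\to\mathcal V$ such that (a) $T$ preserves weak pullbacks and every naturality square of $m$ is a weak pullback; (b) $(\mathcal V,\xi)$ is an Eilenberg–Moore $\mathbb T$-algebra, $\xi\cdot T(\otimes)=\otimes\cdot\langle\xi\cdot T\pi_1,\xi\cdot T\pi_2\rangle$ on $T(\mathcal V\times\mathcal V)$, and $\xi\cdot T(k)$ is constant $k$ on $T1$ (with $k:1\to\mathcal V$); (c) for every map $f:X\to Y$ and $\varphi:X\to\mathcal V$, $\xi\cdot T(f_!\varphi)=(Tf)_!(\xi\cdot T\varphi)$, where $f_!\varphi(y)=\bigvee_{f(x)=y}\varphi(x)$. **Relations.** A $\mathcal V$-relation $r:X\nrightarrow Y$ is a map $X\times Y\to\mathcal V$, ordered pointwise; $(s\cdot r)(x,z)=\bigvee_y r(x,y)\otimes s(y,z)$; $r^\circ(y,x)=r(x,y)$; a map $f$ is identified with the relation with value $k$ if $f(x)=y$ and $\bot$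 otherwise. $T_\xi r:TX\nrightarrow TY$ is $T_\xi r(\mathfrak x,\mathfrak y)=\bigvee\{\xi\cdot Tr(\mathfrak w)\mid \mathfrak w\in T(X\times Y),T\pi_1(\mathfrak w)=\mathfrak x,T\pi_2(\mathfrak w)=\mathfrak y\}$. **$\mathcal T$-graphs.** A $\mathcal T$-graph is $(X,a)$ with $a:TX\nrightarrow X$ and $e_X^\circ\le a$; it is a $\mathcal T$-category if moreover $a\cdot T_\xi a\cdot m_X^\circ\le a$. A $\mathcal T$-functor $f:(X,a)\to(Y,b)$ is a map with $a(\mathfrak x,x)\le b(Tf(\mathfrak x),f(x))$. A $\mathcal T$-graph $(X,a)$ is dualisable if $a_0=a\cdot e_X$ satisfies $a_0\cdot a_0\le a_0$ and $a=a_0\cdot\alpha$ for some map $\alpha:TX\to X$; its dual is the $\mathcal T$-graph $X^{\mathrm{op}}=(X,a_0^\circ\cdot\alpha)$, independent of $\alpha$. **Exponential.** $\mathcal V$ is a $\mathcal T$-category with structure $(\mathfrak v,v)\mapsto\hom(\xi(\mathfrak v),v)$. For a $\mathcal T$-category $X=(X,a)$, $\mathcal V^X$ is the set of $\mathcal T$-functors $X\to\mathcal V$ with the $\mathcal T$-graph structure $d(\mathfrak p,h)=\bigwedge\hom(a(T\pi_2(\mathfrak q),x),\hom(\xi\cdot T\mathrm{ev}(\mathfrak q),h(x)))$, the infimum over all $x\in X$ and $\mathfrak q\in T(\mathcal V^X\times X)$ with $T\pi_1(\mathfrak q)=\mathfrak p$, where $\mathrm{ev}(h,x)=h(x)$.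 It is dualisable. With $\mathrm{ev}$ regarded as a $\mathcal V$-relation $\mathcal V^X\nrightarrow X$ and $\mu=a\cdot T_\xi\mathrm{ev}:T(\mathcal V^X)\nrightarrow X$, one has $\mu(\mathfrak p,-)\in\mathcal V^X$, $d(\mathfrak p,h)=\bigwedge_x\hom(\mu(\mathfrak p,x),h(x))$, and the structure of $(\mathcal V^X)^{\mathrm{op}}$ is $(\mathfrak p,h)\mapsto\bigwedge_{x\in X}\hom(h(x),\mu(\mathfrak p,x))$. *)

theory Defs
  imports Main "HOL-Library.FuncSet"
begin

section \<open>The category Set\<close>

text \<open>
  A monad on Set is an assignment on all sets, so it cannot be a family of HOL types. Set is
  therefore the category of sets and functions of a set-theoretic universe, an arbitrary HOL type
  with an extensional membership relation that is closed under the ZF operations. Replacement is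
  second order: it holds for every HOL function, so every HOL subset of a set of the universe is a
  set of the universe. Foundation and infinity are not required; Grothendieck universes are
  models, and so are the hereditarily finite sets.
\<close>

class set_universe =
  fixes elts :: "'a \<Rightarrow> 'a set"
  assumes elts_inject: "elts x = elts y \<Longrightarrow> x = y"
    and ex_empty: "\<exists>z. elts z = {}"
    and ex_pair: "\<exists>z. elts z = {x, y}"
    and ex_Union: "\<exists>z. elts z = \<Union> (elts ` elts x)"
    and ex_Pow: "\<exists>z. elts z = {y. elts y \<subseteq> elts x}"
    and ex_image: "\<exists>z. elts z = f ` elts x"

text \<open>
  The objects of Set are the small \<open>A :: 'u set\<close>. Morphisms \<open>A \<rightarrow> B\<close> are HOL functions in
  \<open>A \<rightarrow> B\<close>, and two of them are equal when they agree on \<open>A\<close>.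
\<close>

definition small :: "'u::set_universe set \<Rightarrow> bool" where
  "small A \<longleftrightarrow> A \<in> range elts"

definition uset :: "'u::set_universe set \<Rightarrow> 'u" where
  "uset A = (THE z. elts z = A)"

definition upair :: "'u::set_universe \<Rightarrow> 'u \<Rightarrow> 'u" where
  "upair x y = uset {uset {x}, uset {x, y}}"

definition ufst :: "'u::set_universe \<Rightarrow> 'u" where
  "ufst p = (THE x. \<exists>y. p = upair x y)"

definition usnd :: "'u::set_universe \<Rightarrow> 'u" where
  "usnd p = (THE y. \<exists>x. p = upair x y)"

definition utimes :: "'u::set_universe set \<Rightarrow> 'u set \<Rightarrow> 'u set" where
  "utimes A B = {upair x y | x y. x \<in> A \<and> y \<in> B}"

definition uone :: "'u::set_universe set" where
  "uone = {uset {}}"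

text \<open>The function \<open>f\<close> restricted to \<open>A\<close>, as an element of the universe (its graph).\<close>

definition ulam :: "'u::set_universe set \<Rightarrow> ('u \<Rightarrow> 'u) \<Rightarrow> 'u" where
  "ulam A f = uset {upair x (f x) | x. x \<in> A}"

definition uapp :: "'u::set_universe \<Rightarrow> 'u \<Rightarrow> 'u" where
  "uapp h x = (THE y. upair x y \<in> elts h)"

lemma elts_uset: "small A \<Longrightarrow> elts (uset A) = A"
  unfolding small_def uset_def by (rule theI') (auto dest: elts_inject)

lemma small_pair: "small {x, y}"
  using ex_pair[of x y] by (auto simp: small_def image_iff)

lemma small_singleton: "small {x}"
  using small_pair[of x x] by simp

lemma upair_inject: "upair x y = upair x' y' \<longleftrightarrow> x = x' \<and> y = y'"
proof
  assume "upair x y = upair x' y'"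
  then have "{uset {x}, uset {x, y}} = {uset {x'}, uset {x', y'}}"
    unfolding upair_def by (metis elts_uset small_pair)
  then have "(\<lambda>z. elts z) ` {uset {x}, uset {x, y}} = (\<lambda>z. elts z) ` {uset {x'}, uset {x', y'}}"
    by simp
  then have "{{x}, {x, y}} = {{x'}, {x', y'}}"
    by (simp add: elts_uset small_pair small_singleton)
  then show "x = x' \<and> y = y'"
    by (auto simp: doubleton_eq_iff)
qed simp

lemma ufst_upair: "ufst (upair x y) = x" and usnd_upair: "usnd (upair x y) = y"
  by (simp_all add: ufst_def usnd_def upair_inject)

lemma uapp_ulam: "small A \<Longrightarrow> x \<in> A \<Longrightarrow> uapp (ulam A f) x = f x"
proof -
  assume A: "small A" and x: "x \<in> A"
  have "{upair x (f x) | x. x \<in> A} = (\<lambda>x. upair x (f x)) ` A" by auto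
  moreover have "small ((\<lambda>x. upair x (f x)) ` A)"
  proof -
    obtain z where "A = elts z" using A unfolding small_def by blast
    then show ?thesis using ex_image[of "\<lambda>x. upair x (f x)" z] unfolding small_def by force
  qed
  ultimately have "elts (ulam A f) = {upair x (f x) | x. x \<in> A}"
    by (simp add: ulam_def elts_uset)
  then show ?thesis using x by (simp add: uapp_def upair_inject)
qed

definition weak_pullback ::
  "'u::set_universe set \<Rightarrow> 'u set \<Rightarrow> 'u set \<Rightarrow> 'u set \<Rightarrow>
    ('u \<Rightarrow> 'u) \<Rightarrow> ('u \<Rightarrow> 'u) \<Rightarrow> ('u \<Rightarrow> 'u) \<Rightarrow> ('u \<Rightarrow> 'u) \<Rightarrow> bool" where
  "weak_pullback P A B C p q f g \<longleftrightarrow>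
     small P \<and> small A \<and> small B \<and> small C \<and>
     p \<in> P \<rightarrow> A \<and> q \<in> P \<rightarrow> B \<and> f \<in> A \<rightarrow> C \<and> g \<in> B \<rightarrow> C \<and>
     (\<forall>w\<in>P. f (p w) = g (q w)) \<and>
     (\<forall>(Z :: 'u set) u v. small Z \<and> u \<in> Z \<rightarrow> A \<and> v \<in> Z \<rightarrow> B \<and> (\<forall>z\<in>Z. f (u z) = g (v z)) \<longrightarrow>
        (\<exists>w \<in> Z \<rightarrow> P. \<forall>z\<in>Z. p (w z) = u z \<and> q (w z) = v z))"


section \<open>Monads on Set\<close>

text \<open>\<open>Tmap M A B f\<close> is \<open>T f : T A \<rightarrow> T B\<close> for \<open>f : A \<rightarrow> B\<close>; the codomain is part of a morphism.\<close>

record 'u set_monad =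
  Tobj :: "'u set \<Rightarrow> 'u set"
  Tmap :: "'u set \<Rightarrow> 'u set \<Rightarrow> ('u \<Rightarrow> 'u) \<Rightarrow> 'u \<Rightarrow> 'u"
  Tunit :: "'u set \<Rightarrow> 'u \<Rightarrow> 'u"
  Tmult :: "'u set \<Rightarrow> 'u \<Rightarrow> 'u"

definition is_functor :: "('u::set_universe, 'z) set_monad_scheme \<Rightarrow> bool" where
  "is_functor M \<longleftrightarrow>
     (\<forall>A. small A \<longrightarrow> small (Tobj M A)) \<and>
     (\<forall>A B f. small A \<and> small B \<and> f \<in> A \<rightarrow> B \<longrightarrow> Tmap M A B f \<in> Tobj M A \<rightarrow> Tobj M B) \<and>
     (\<forall>A B f g. small A \<and> small B \<and> f \<in> A \<rightarrow> B \<and> (\<forall>x\<in>A. f x = g x) \<longrightarrow>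
        (\<forall>t\<in>Tobj M A. Tmap M A B f t = Tmap M A B g t)) \<and>
     (\<forall>A. small A \<longrightarrow> (\<forall>t\<in>Tobj M A. Tmap M A A (\<lambda>x. x) t = t)) \<and>
     (\<forall>A B C f g. small A \<and> small B \<and> small C \<and> f \<in> A \<rightarrow> B \<and> g \<in> B \<rightarrow> C \<longrightarrow>
        (\<forall>t\<in>Tobj M A. Tmap M A C (g \<circ> f) t = Tmap M B C g (Tmap M A B f t)))"

definition is_monad :: "('u::set_universe, 'z) set_monad_scheme \<Rightarrow> bool" where
  "is_monad M \<longleftrightarrow>
     is_functor M \<and>
     (\<forall>A. small A \<longrightarrow> Tunit M A \<in> A \<rightarrow> Tobj M A) \<and>
     (\<forall>A. small A \<longrightarrow> Tmult M A \<in> Tobj M (Tobj M A) \<rightarrow> Tobj M A) \<and>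
     (\<forall>A B f. small A \<and> small B \<and> f \<in> A \<rightarrow> B \<longrightarrow>
        (\<forall>x\<in>A. Tmap M A B f (Tunit M A x) = Tunit M B (f x))) \<and>
     (\<forall>A B f. small A \<and> small B \<and> f \<in> A \<rightarrow> B \<longrightarrow>
        (\<forall>t\<in>Tobj M (Tobj M A).
           Tmap M A B f (Tmult M A t) = Tmult M B (Tmap M (Tobj M A) (Tobj M B) (Tmap M A B f) t))) \<and>
     (\<forall>A. small A \<longrightarrow> (\<forall>t\<in>Tobj M A. Tmult M A (Tunit M (Tobj M A) t) = t)) \<and>
     (\<forall>A. small A \<longrightarrow> (\<forall>t\<in>Tobj M A. Tmult M A (Tmap M A (Tobj M A) (Tunit M A) t) = t)) \<and>
     (\<forall>A. small A \<longrightarrow> (\<forall>t\<in>Tobj M (Tobj M (Tobj M A)).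
        Tmult M A (Tmult M (Tobj M A) t) =
        Tmult M A (Tmap M (Tobj M (Tobj M A)) (Tobj M A) (Tmult M A) t)))"

definition preserves_weak_pullbacks :: "('u::set_universe, 'z) set_monad_scheme \<Rightarrow> bool" where
  "preserves_weak_pullbacks M \<longleftrightarrow>
     (\<forall>P A B C p q f g. weak_pullback P A B C p q f g \<longrightarrow>
        weak_pullback (Tobj M P) (Tobj M A) (Tobj M B) (Tobj M C)
          (Tmap M P A p) (Tmap M P B q) (Tmap M A C f) (Tmap M B C g))"

definition mult_weak_pullbacks :: "('u::set_universe, 'z) set_monad_scheme \<Rightarrow> bool" where
  "mult_weak_pullbacks M \<longleftrightarrow>
     (\<forall>A B f. small A \<and> small B \<and> f \<in> A \<rightarrow> B \<longrightarrow>
        weak_pullback (Tobj M (Tobj M A)) (Tobj M (Tobj M B)) (Tobj M A) (Tobj M B)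
          (Tmap M (Tobj M A) (Tobj M B) (Tmap M A B f)) (Tmult M A)
          (Tmult M B) (Tmap M A B f))"


section \<open>Quantales and topological theories\<close>

class comm_quantale = complete_lattice + comm_monoid_mult +
  assumes mult_Sup: "x * Sup A = (SUP y\<in>A. x * y)"

definition qhom :: "'v::comm_quantale \<Rightarrow> 'v \<Rightarrow> 'v" where
  "qhom y z = Sup {x. x * y \<le> z}"

lemma quantale_mult_mono: "x \<le> y \<Longrightarrow> z * x \<le> z * (y::'v::comm_quantale)"
proof -
  assume "x \<le> y"
  then have "Sup {x, y} = y" by (simp add: sup_absorb2)
  moreover have "z * x \<le> (SUP w\<in>{x, y}. z * w)" by (rule SUP_upper) simp
  ultimately show "z * x \<le> z * y" by (metis mult_Sup)
qed

lemma le_qhom_iff: "x \<le> qhom y z \<longleftrightarrow> x * y \<le> (z::'v::comm_quantale)"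
proof
  assume "x \<le> qhom y z"
  then have "x * y \<le> y * qhom y z"
    by (subst mult.commute) (rule quantale_mult_mono)
  also have "\<dots> \<le> z"
    unfolding qhom_def mult_Sup by (rule SUP_least) (simp add: mult.commute)
  finally show "x * y \<le> z" .
qed (simp add: qhom_def Sup_upper)

text \<open>
  The quantale is the type \<open>'v\<close>, with \<open>k\<close> written \<open>1\<close>. Its underlying set must be an object of
  Set, so \<open>quant\<close> embeds \<open>'v\<close> into the universe.
\<close>

record ('u, 'v) theory_data = "'u set_monad" +
  quant :: "'v \<Rightarrow> 'u"
  xi :: "'u \<Rightarrow> 'v"

definition Vset :: "('u::set_universe, 'v::comm_quantale) theory_data \<Rightarrow> 'u set" where
  "Vset \<T> = range (quant \<T>)"

definition Vval :: "('u::set_universe, 'v::comm_quantale) theory_data \<Rightarrow> 'u \<Rightarrow> 'v" where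
  "Vval \<T> = inv (quant \<T>)"

text \<open>The composite \<open>\<xi> \<cdot> T \<phi>\<close> for \<open>\<phi> : X \<rightarrow> \<V>\<close>.\<close>

definition xiT ::
  "('u::set_universe, 'v::comm_quantale) theory_data \<Rightarrow> 'u set \<Rightarrow> ('u \<Rightarrow> 'v) \<Rightarrow> 'u \<Rightarrow> 'v" where
  "xiT \<T> X \<phi> t = xi \<T> (Tmap \<T> X (Vset \<T>) (\<lambda>x. quant \<T> (\<phi> x)) t)"

definition topological_theory ::
  "('u::set_universe, 'v::comm_quantale) theory_data \<Rightarrow> bool" where
  "topological_theory \<T> \<longleftrightarrow>
     is_monad \<T> \<and> inj (quant \<T>) \<and> small (Vset \<T>) \<and>
     preserves_weak_pullbacks \<T> \<and> mult_weak_pullbacks \<T> \<and>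
     (\<forall>v. xi \<T> (Tunit \<T> (Vset \<T>) (quant \<T> v)) = v) \<and>
     (\<forall>w\<in>Tobj \<T> (Tobj \<T> (Vset \<T>)).
        xiT \<T> (Tobj \<T> (Vset \<T>)) (xi \<T>) w = xi \<T> (Tmult \<T> (Vset \<T>) w)) \<and>
     (\<forall>w\<in>Tobj \<T> (utimes (Vset \<T>) (Vset \<T>)).
        xiT \<T> (utimes (Vset \<T>) (Vset \<T>)) (\<lambda>p. Vval \<T> (ufst p) * Vval \<T> (usnd p)) w =
        xi \<T> (Tmap \<T> (utimes (Vset \<T>) (Vset \<T>)) (Vset \<T>) ufst w) *
        xi \<T> (Tmap \<T> (utimes (Vset \<T>) (Vset \<T>)) (Vset \<T>) usnd w)) \<and>
     (\<forall>t\<in>Tobj \<T> uone. xiT \<T> uone (\<lambda>_. 1) t = 1) \<and>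
     (\<forall>X Y f (\<phi> :: 'u \<Rightarrow> 'v). small X \<and> small Y \<and> f \<in> X \<rightarrow> Y \<longrightarrow>
        (\<forall>t\<in>Tobj \<T> Y.
           xiT \<T> Y (\<lambda>y. SUP x\<in>{x \<in> X. f x = y}. \<phi> x) t =
           (SUP s\<in>{s \<in> Tobj \<T> X. Tmap \<T> X Y f s = t}. xiT \<T> X \<phi> s)))"


section \<open>Relations\<close>

text \<open>
  A \<open>\<V>\<close>-relation from \<open>X\<close> to \<open>Y\<close> is an \<open>r :: 'u \<Rightarrow> 'u \<Rightarrow> 'v\<close>; only its values on \<open>X \<times> Y\<close>
  matter. In \<open>rcomp Y s r\<close>, the composite \<open>s \<cdot> r\<close>, \<open>Y\<close> is the object in the middle.
\<close>

definition rle :: "'u set \<Rightarrow> 'u set \<Rightarrow> ('u \<Rightarrow> 'u \<Rightarrow> 'v::comm_quantale) \<Rightarrow> ('u \<Rightarrow> 'u \<Rightarrow> 'v) \<Rightarrow> bool" where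
  "rle X Y r s \<longleftrightarrow> (\<forall>x\<in>X. \<forall>y\<in>Y. r x y \<le> s x y)"

definition rcomp ::
  "'u set \<Rightarrow> ('u \<Rightarrow> 'u \<Rightarrow> 'v::comm_quantale) \<Rightarrow> ('u \<Rightarrow> 'u \<Rightarrow> 'v) \<Rightarrow> 'u \<Rightarrow> 'u \<Rightarrow> 'v" where
  "rcomp Y s r x z = (SUP y\<in>Y. r x y * s y z)"

definition rconv :: "('u \<Rightarrow> 'u \<Rightarrow> 'v) \<Rightarrow> 'u \<Rightarrow> 'u \<Rightarrow> 'v" where
  "rconv r y x = r x y"

definition rmap :: "('u \<Rightarrow> 'u) \<Rightarrow> 'u \<Rightarrow> 'u \<Rightarrow> 'v::comm_quantale" where
  "rmap f x y = (if f x = y then 1 else bot)"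

definition Trel ::
  "('u::set_universe, 'v::comm_quantale) theory_data \<Rightarrow> 'u set \<Rightarrow> 'u set \<Rightarrow>
    ('u \<Rightarrow> 'u \<Rightarrow> 'v) \<Rightarrow> 'u \<Rightarrow> 'u \<Rightarrow> 'v" where
  "Trel \<T> X Y r \<xx> \<yy> =
     (SUP w\<in>{w \<in> Tobj \<T> (utimes X Y).
               Tmap \<T> (utimes X Y) X ufst w = \<xx> \<and> Tmap \<T> (utimes X Y) Y usnd w = \<yy>}.
        xiT \<T> (utimes X Y) (\<lambda>p. r (ufst p) (usnd p)) w)"


section \<open>Graphs, categories, functors and duals\<close>

definition t_graph ::
  "('u::set_universe, 'v::comm_quantale) theory_data \<Rightarrow> 'u set \<Rightarrow> ('u \<Rightarrow> 'u \<Rightarrow> 'v) \<Rightarrow> bool" where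
  "t_graph \<T> X a \<longleftrightarrow> small X \<and> rle (Tobj \<T> X) X (rconv (rmap (Tunit \<T> X))) a"

definition t_category ::
  "('u::set_universe, 'v::comm_quantale) theory_data \<Rightarrow> 'u set \<Rightarrow> ('u \<Rightarrow> 'u \<Rightarrow> 'v) \<Rightarrow> bool" where
  "t_category \<T> X a \<longleftrightarrow> t_graph \<T> X a \<and>
     rle (Tobj \<T> X) X
       (rcomp (Tobj \<T> X) a
         (rcomp (Tobj \<T> (Tobj \<T> X)) (Trel \<T> (Tobj \<T> X) X a) (rconv (rmap (Tmult \<T> X)))))
       a"

definition t_functor ::
  "('u::set_universe, 'v::comm_quantale) theory_data \<Rightarrow> 'u set \<Rightarrow> ('u \<Rightarrow> 'u \<Rightarrow> 'v) \<Rightarrow>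
    'u set \<Rightarrow> ('u \<Rightarrow> 'u \<Rightarrow> 'v) \<Rightarrow> ('u \<Rightarrow> 'u) \<Rightarrow> bool" where
  "t_functor \<T> X a Y b f \<longleftrightarrow>
     f \<in> X \<rightarrow> Y \<and> (\<forall>\<xx>\<in>Tobj \<T> X. \<forall>x\<in>X. a \<xx> x \<le> b (Tmap \<T> X Y f \<xx>) (f x))"

definition underlying ::
  "('u::set_universe, 'v::comm_quantale) theory_data \<Rightarrow> 'u set \<Rightarrow> ('u \<Rightarrow> 'u \<Rightarrow> 'v) \<Rightarrow> 'u \<Rightarrow> 'u \<Rightarrow> 'v" where
  "underlying \<T> X a = rcomp (Tobj \<T> X) a (rmap (Tunit \<T> X))"

definition represents ::
  "('u::set_universe, 'v::comm_quantale) theory_data \<Rightarrow> 'u set \<Rightarrow> ('u \<Rightarrow> 'u \<Rightarrow> 'v) \<Rightarrow> ('u \<Rightarrow> 'u) \<Rightarrow> bool" where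
  "represents \<T> X a \<alpha> \<longleftrightarrow>
     \<alpha> \<in> Tobj \<T> X \<rightarrow> X \<and>
     (\<forall>\<xx>\<in>Tobj \<T> X. \<forall>x\<in>X. a \<xx> x = rcomp X (underlying \<T> X a) (rmap \<alpha>) \<xx> x)"

definition dualisable ::
  "('u::set_universe, 'v::comm_quantale) theory_data \<Rightarrow> 'u set \<Rightarrow> ('u \<Rightarrow> 'u \<Rightarrow> 'v) \<Rightarrow> bool" where
  "dualisable \<T> X a \<longleftrightarrow>
     t_graph \<T> X a \<and>
     rle X X (rcomp X (underlying \<T> X a) (underlying \<T> X a)) (underlying \<T> X a) \<and>
     (\<exists>\<alpha>. represents \<T> X a \<alpha>)"

text \<open>The dual of a dualisable graph; by \<open>dual_eq\<close> below the choice of \<open>\<alpha>\<close> is immaterial.\<close>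

definition dual ::
  "('u::set_universe, 'v::comm_quantale) theory_data \<Rightarrow> 'u set \<Rightarrow> ('u \<Rightarrow> 'u \<Rightarrow> 'v) \<Rightarrow> 'u \<Rightarrow> 'u \<Rightarrow> 'v" where
  "dual \<T> X a = rcomp X (rconv (underlying \<T> X a)) (rmap (SOME \<alpha>. represents \<T> X a \<alpha>))"

lemma rcomp_rmap:
  assumes "f x \<in> Y"
  shows "rcomp Y s (rmap f) x z = (s (f x) z :: 'v::comm_quantale)"
proof -
  have bot: "(bot::'v) * v = bot" for v
    using mult_Sup[of v "{}"] by (simp add: mult.commute)
  show ?thesis
    unfolding rcomp_def rmap_def using assms
    by (intro antisym SUP_least SUP_upper2[of "f x"]) (auto simp: bot)
qed

lemma dual_eq:
  assumes M: "is_monad \<T>" and d: "dualisable \<T> X a" and \<alpha>: "represents \<T> X a \<alpha>"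
    and \<xx>: "\<xx> \<in> Tobj \<T> X" and x: "x \<in> X"
  shows "dual \<T> X a \<xx> x = rcomp X (rconv (underlying \<T> X a)) (rmap \<alpha>) \<xx> x"
proof -
  let ?a = "underlying \<T> X a"
  have small: "small X" and refl: "rle (Tobj \<T> X) X (rconv (rmap (Tunit \<T> X))) a"
    and trans: "rle X X (rcomp X ?a ?a) ?a"
    using d by (auto simp: dualisable_def t_graph_def)
  have e: "Tunit \<T> X y \<in> Tobj \<T> X" if "y \<in> X" for y
    using M small that by (auto simp: is_monad_def)
  have refl0: "1 \<le> ?a y y" if "y \<in> X" for y
    using refl e[OF that] that unfolding underlying_def
    by (force simp: rcomp_rmap rle_def rconv_def rmap_def)
  have trans0: "?a x y * ?a y z \<le> ?a x z" if "x \<in> X" "y \<in> X" "z \<in> X" for x y z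
  proof -
    have "?a x y * ?a y z \<le> rcomp X ?a ?a x z"
      unfolding rcomp_def by (rule SUP_upper) (rule that(2))
    also have "\<dots> \<le> ?a x z" using trans that by (simp add: rle_def)
    finally show ?thesis .
  qed
  have le: "?a x (\<beta> \<xx>) \<le> ?a x (\<gamma> \<xx>)" if b: "represents \<T> X a \<beta>" and c: "represents \<T> X a \<gamma>" for \<beta> \<gamma>
  proof -
    have bX: "\<beta> \<xx> \<in> X" and cX: "\<gamma> \<xx> \<in> X"
      using b c \<xx> by (auto simp: represents_def)
    have "?a (\<beta> \<xx>) (\<gamma> \<xx>) = a \<xx> (\<gamma> \<xx>)" "?a (\<gamma> \<xx>) (\<gamma> \<xx>) = a \<xx> (\<gamma> \<xx>)"
      using b c \<xx> bX cX by (auto simp: represents_def rcomp_rmap)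
    then have "1 \<le> ?a (\<beta> \<xx>) (\<gamma> \<xx>)" using refl0[OF cX] by simp
    then have "?a x (\<beta> \<xx>) * 1 \<le> ?a x (\<beta> \<xx>) * ?a (\<beta> \<xx>) (\<gamma> \<xx>)" by (rule quantale_mult_mono)
    also have "\<dots> \<le> ?a x (\<gamma> \<xx>)" using trans0[OF x bX cX] .
    finally show ?thesis by simp
  qed
  define \<beta> where "\<beta> = (SOME \<alpha>. represents \<T> X a \<alpha>)"
  have \<beta>: "represents \<T> X a \<beta>" unfolding \<beta>_def by (rule someI[of "represents \<T> X a", OF \<alpha>])
  have "\<alpha> \<xx> \<in> X" "\<beta> \<xx> \<in> X" using \<alpha> \<beta> \<xx> by (auto simp: represents_def)
  then show ?thesis
    using le[OF \<alpha> \<beta>] le[OF \<beta> \<alpha>]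
    unfolding dual_def \<beta>_def[symmetric] by (simp add: rcomp_rmap rconv_def)
qed


section \<open>The exponential\<close>

definition Vstr :: "('u::set_universe, 'v::comm_quantale) theory_data \<Rightarrow> 'u \<Rightarrow> 'u \<Rightarrow> 'v" where
  "Vstr \<T> \<vv> v = qhom (xi \<T> \<vv>) (Vval \<T> v)"

definition Vexp ::
  "('u::set_universe, 'v::comm_quantale) theory_data \<Rightarrow> 'u set \<Rightarrow> ('u \<Rightarrow> 'u \<Rightarrow> 'v) \<Rightarrow> 'u set" where
  "Vexp \<T> X a = {ulam X f | f. t_functor \<T> X a (Vset \<T>) (Vstr \<T>) f}"

definition Vev :: "('u::set_universe, 'v::comm_quantale) theory_data \<Rightarrow> 'u \<Rightarrow> 'u \<Rightarrow> 'v" where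
  "Vev \<T> h x = Vval \<T> (uapp h x)"

definition Vexp_str ::
  "('u::set_universe, 'v::comm_quantale) theory_data \<Rightarrow> 'u set \<Rightarrow> ('u \<Rightarrow> 'u \<Rightarrow> 'v) \<Rightarrow> 'u \<Rightarrow> 'u \<Rightarrow> 'v" where
  "Vexp_str \<T> X a \<pp> h =
     (let P = utimes (Vexp \<T> X a) X in
      INF (x, \<qq>) \<in> X \<times> {\<qq> \<in> Tobj \<T> P. Tmap \<T> P (Vexp \<T> X a) ufst \<qq> = \<pp>}.
        qhom (a (Tmap \<T> P X usnd \<qq>) x)
          (qhom (xiT \<T> P (\<lambda>p. Vev \<T> (ufst p) (usnd p)) \<qq>) (Vev \<T> h x)))"


end

theory Submission
  imports Defs
begin

text \<open>
  Write \<open>T\<^sub>\<xi>\<close> for the extension \<^const>\<open>Trel\<close> of the functor to \<open>\<V>\<close>-relations and put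
  \<open>\<mu> = a \<cdot> T\<^sub>\<xi> ev\<close>, a relation from \<open>T (\<V>\<^sup>X)\<close> to \<open>X\<close>. The infimum that defines the structure
  \<open>d\<close> of the exponential says that \<open>c \<le> d (\<pp>, h)\<close> iff \<open>c \<otimes> \<mu> (\<pp>, x) \<le> h x\<close> for all \<open>x\<close>. Two facts
  make the dual equally explicit. First, \<open>\<mu> (e h, -) = h\<close>, so that the underlying order of \<open>d\<close> is
  the pointwise order of \<open>\<V>\<close>-valued maps. Second, \<open>\<mu> (\<pp>, -)\<close> is itself a point of \<open>\<V>\<^sup>X\<close>, so that
  \<open>\<pp> \<mapsto> \<mu> (\<pp>, -)\<close> represents \<open>d\<close>; this is where \<open>T 1 = 1\<close> enters. Hence the structure \<open>D\<close> of the
  dual is characterised by: \<open>c \<le> D (\<pp>, h)\<close> iff \<open>c \<otimes> h x \<le> \<mu> (\<pp>, x)\<close> for all \<open>x\<close>.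

  In other words, \<open>D\<close> is the largest relation with \<open>ev \<cdot> D \<le> \<mu>\<close>. Transitivity of \<open>D\<close> therefore
  amounts to \<open>\<mu> \<cdot> T\<^sub>\<xi> D \<le> \<mu> \<cdot> m\<close>, and
  \<open>\<mu> \<cdot> T\<^sub>\<xi> D = a \<cdot> T\<^sub>\<xi> ev \<cdot> T\<^sub>\<xi> D \<le> a \<cdot> T\<^sub>\<xi> (ev \<cdot> D) \<le> a \<cdot> T\<^sub>\<xi> \<mu>\<close>,
  so everything reduces to the closure property \<open>a \<cdot> T\<^sub>\<xi> \<mu> \<le> \<mu> \<cdot> m\<close> (lemma \<open>\<mu>_closed\<close>). The latter
  holds because \<open>X\<close> is a category:
  \<open>a \<cdot> T\<^sub>\<xi> (a \<cdot> T\<^sub>\<xi> ev) \<le> a \<cdot> T\<^sub>\<xi> a \<cdot> T\<^sub>\<xi> (T\<^sub>\<xi> ev) \<le> a \<cdot> m \<cdot> T\<^sub>\<xi> (T\<^sub>\<xi> ev) \<le> a \<cdot> T\<^sub>\<xi> ev \<cdot> m\<close>.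
  The same property, at the unit of \<open>\<pp>\<close>, shows that \<open>\<mu> (\<pp>, -)\<close> is a \<open>\<T>\<close>-functor.

  The facts about relations that these chains use are that \<open>T\<^sub>\<xi>\<close> preserves composition
  (\<open>Trel_comp_le\<close>, \<open>Trel_comp_ge\<close>) and that \<open>m\<close> is lax natural for it (\<open>Trel_mult\<close>).
\<close>

section \<open>Sets of the universe\<close>

lemma smallI: "elts z = A \<Longrightarrow> small A"
  by (auto simp: small_def)

lemma smallE: assumes "small A" obtains z where "elts z = A"
  using assms by (auto simp: small_def)

lemma small_image:
  fixes f :: "'u::set_universe \<Rightarrow> 'u"
  assumes A: "small A" shows "small (f ` A)"
proof -
  obtain z where z: "elts z = A" using A by (rule smallE)
  obtain y where "elts y = f ` elts z" using ex_image[of f z] by (elim exE)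
  then show ?thesis by (auto intro: smallI simp: z)
qed

lemma small_empty: "small {}"
  using ex_empty by (auto intro: smallI)

text \<open>Second-order replacement gives separation: a nonempty subset is the image of a retraction.\<close>

lemma small_subset:
  assumes A: "small A" and B: "B \<subseteq> A" shows "small B"
proof (cases "B = {}")
  case False
  then obtain b where "b \<in> B" by blast
  then have "(\<lambda>x. if x \<in> B then x else b) ` A = B" using B by auto
  then show ?thesis using small_image[OF A, of "\<lambda>x. if x \<in> B then x else b"] by simp
qed (simp add: small_empty)

lemma small_UN:
  fixes F :: "'u::set_universe \<Rightarrow> 'u set"
  assumes A: "small A" and F: "\<And>x. x \<in> A \<Longrightarrow> small (F x)" shows "small (\<Union>x\<in>A. F x)"
proof -
  have "small ((\<lambda>x. uset (F x)) ` A)" by (rule small_image[OF A])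
  then obtain z where z: "elts z = (\<lambda>x. uset (F x)) ` A" by (rule smallE)
  have "\<Union> (elts ` elts z) = (\<Union>x\<in>A. F x)" unfolding z using F by (simp add: elts_uset)
  then show ?thesis using ex_Union[of z] by (auto intro: smallI)
qed

lemma utimes_eq: "utimes A B = (\<Union>x\<in>A. (\<lambda>y. upair x y) ` B)"
  by (auto simp: utimes_def)

lemma small_utimes: "small A \<Longrightarrow> small B \<Longrightarrow> small (utimes A B)"
  unfolding utimes_eq by (intro small_UN small_image)

lemma small_uone: "small uone"
  by (simp add: uone_def small_singleton)

lemma utimesE:
  assumes "p \<in> utimes A B" obtains x y where "p = upair x y" "x \<in> A" "y \<in> B"
  using assms by (auto simp: utimes_def)

lemma upair_in_utimes [simp]: "upair x y \<in> utimes A B \<longleftrightarrow> x \<in> A \<and> y \<in> B"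
  by (auto simp: utimes_def upair_inject)

lemma ufst_in: "p \<in> utimes A B \<Longrightarrow> ufst p \<in> A" and usnd_in: "p \<in> utimes A B \<Longrightarrow> usnd p \<in> B"
  by (auto simp: utimes_def ufst_upair usnd_upair)

declare ufst_upair [simp] usnd_upair [simp]

lemma small_functions:
  assumes X: "small X" and Y: "small Y"
  shows "small {ulam X f | f. f \<in> X \<rightarrow> Y}"
proof -
  obtain z where z: "elts z = utimes X Y"
    using small_utimes[OF X Y] by (rule smallE)
  obtain P where P: "elts P = {y. elts y \<subseteq> elts z}" using ex_Pow[of z] by blast
  have "{ulam X f | f. f \<in> X \<rightarrow> Y} \<subseteq> elts P"
  proof clarify
    fix f assume f: "f \<in> X \<rightarrow> Y"
    have sub: "{upair x (f x) | x. x \<in> X} \<subseteq> utimes X Y" using f by auto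
    then have "elts (ulam X f) = {upair x (f x) | x. x \<in> X}"
      unfolding ulam_def by (rule elts_uset[OF small_subset[OF small_utimes[OF X Y]]])
    then show "ulam X f \<in> elts P" using sub by (simp add: P z)
  qed
  then show ?thesis by (rule small_subset[OF smallI[OF refl]])
qed

text \<open>A weak pullback in Set is a square whose comparison map to the pullback is onto.\<close>

lemma weak_pullbackI:
  assumes "small P" "small A" "small B" "small C"
    and "p \<in> P \<rightarrow> A" "q \<in> P \<rightarrow> B" "f \<in> A \<rightarrow> C" "g \<in> B \<rightarrow> C"
    and "\<And>w. w \<in> P \<Longrightarrow> f (p w) = g (q w)"
    and lift: "\<And>x y. x \<in> A \<Longrightarrow> y \<in> B \<Longrightarrow> f x = g y \<Longrightarrow> \<exists>w\<in>P. p w = x \<and> q w = y"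
  shows "weak_pullback P A B C p q f g"
proof -
  have "\<exists>w \<in> Z \<rightarrow> P. \<forall>z\<in>Z. p (w z) = u z \<and> q (w z) = v z"
    if "u \<in> Z \<rightarrow> A" "v \<in> Z \<rightarrow> B" "\<forall>z\<in>Z. f (u z) = g (v z)" for Z :: "'a set" and u v
  proof -
    have "\<forall>z\<in>Z. \<exists>w\<in>P. p w = u z \<and> q w = v z" using that lift by blast
    then obtain w where "\<forall>z\<in>Z. w z \<in> P \<and> p (w z) = u z \<and> q (w z) = v z" by metis
    then show ?thesis by (intro bexI[of _ w]) auto
  qed
  then show ?thesis
    unfolding weak_pullback_def
    by (intro conjI ballI allI impI) (use assms(1-9) in \<open>simp_all\<close>)
qed

lemma weak_pullback_lift:
  fixes P :: "'u::set_universe set"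
  assumes wp: "weak_pullback P A B C p q f g" and "x \<in> A" "y \<in> B" "f x = g y"
  shows "\<exists>w\<in>P. p w = x \<and> q w = y"
proof -
  have *: "\<exists>w \<in> (uone :: 'u set) \<rightarrow> P. \<forall>z\<in>uone. p (w z) = u z \<and> q (w z) = v z"
    if "u \<in> uone \<rightarrow> A" "v \<in> uone \<rightarrow> B" "\<forall>z\<in>uone. f (u z) = g (v z)" for u v :: "'u \<Rightarrow> 'u"
    using wp that small_uone unfolding weak_pullback_def by blast
  have "\<exists>w \<in> (uone :: 'u set) \<rightarrow> P. \<forall>z\<in>uone. p (w z) = x \<and> q (w z) = y"
    by (rule *[of "\<lambda>_. x" "\<lambda>_. y"]) (use assms in simp_all)
  then show ?thesis by (auto simp: uone_def)
qed


section \<open>Quantale arithmetic\<close>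

lemma quantale_mult_SUP: "(x::'v::comm_quantale) * (SUP i\<in>I. f i) = (SUP i\<in>I. x * f i)"
  by (simp add: mult_Sup image_image)

lemma quantale_SUP_mult: "(SUP i\<in>I. f i) * (x::'v::comm_quantale) = (SUP i\<in>I. f i * x)"
  using quantale_mult_SUP[of x f I] by (simp add: mult.commute)

lemma quantale_mult_mono2:
  assumes "x \<le> x'" "y \<le> y'" shows "x * y \<le> x' * (y'::'v::comm_quantale)"
proof -
  have "x * y \<le> x * y'" by (rule quantale_mult_mono[OF assms(2)])
  also have "\<dots> = y' * x" by (rule mult.commute)
  also have "\<dots> \<le> y' * x'" by (rule quantale_mult_mono[OF assms(1)])
  finally show ?thesis by (simp add: mult.commute)
qed

lemma rcomp_upper: "y \<in> Y \<Longrightarrow> r x y * s y z \<le> rcomp Y s r x z"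
  unfolding rcomp_def by (rule SUP_upper)

lemma rcomp_leI: "(\<And>y. y \<in> Y \<Longrightarrow> r x y * s y z \<le> c) \<Longrightarrow> rcomp Y s r x z \<le> c"
  unfolding rcomp_def by (rule SUP_least)


section \<open>The functor and the extension of \<V>-valued maps\<close>

locale top_theory =
  fixes \<T> :: "('u::set_universe, 'v::comm_quantale) theory_data" (structure)
  assumes topological_theory: "topological_theory \<T>"
begin

lemma monad: "is_monad \<T>" and inj_quant: "inj (quant \<T>)" and small_V: "small (Vset \<T>)"
  using topological_theory by (auto simp: topological_theory_def)

lemma T_functor: "is_functor \<T>"
  using monad by (simp add: is_monad_def)

lemmas T_functor_laws = T_functor[unfolded is_functor_def]
lemmas monad_laws = monad[unfolded is_monad_def]

lemmas small_T = T_functor_laws[THEN conjunct1, rule_format]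

lemma Tmap_in: "small A \<Longrightarrow> small B \<Longrightarrow> f \<in> A \<rightarrow> B \<Longrightarrow> t \<in> Tobj \<T> A \<Longrightarrow> Tmap \<T> A B f t \<in> Tobj \<T> B"
  by (rule funcset_mem[OF T_functor_laws[THEN conjunct2, THEN conjunct1, rule_format]]) auto

lemma Tmap_cong:
  assumes "small A" "small B" "f \<in> A \<rightarrow> B" "\<And>x. x \<in> A \<Longrightarrow> f x = g x" "t \<in> Tobj \<T> A"
  shows "Tmap \<T> A B f t = Tmap \<T> A B g t"
  by (rule T_functor_laws[THEN conjunct2, THEN conjunct2, THEN conjunct1, rule_format])
    (use assms in auto)

lemma Tmap_id:
  assumes A: "small A" and f: "\<And>x. x \<in> A \<Longrightarrow> f x = x" and t: "t \<in> Tobj \<T> A"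
  shows "Tmap \<T> A A f t = t"
proof -
  have "Tmap \<T> A A f t = Tmap \<T> A A (\<lambda>x. x) t"
    by (rule Tmap_cong[OF A A _ f t]) (auto simp: f)
  also have "\<dots> = t"
    by (rule T_functor_laws[THEN conjunct2, THEN conjunct2, THEN conjunct2, THEN conjunct1,
          rule_format, OF A t])
  finally show ?thesis .
qed

lemma Tmap_comp:
  assumes "small A" "small B" "small C" "f \<in> A \<rightarrow> B" "g \<in> B \<rightarrow> C" "t \<in> Tobj \<T> A"
    and eq: "\<And>x. x \<in> A \<Longrightarrow> h x = g (f x)"
  shows "Tmap \<T> B C g (Tmap \<T> A B f t) = Tmap \<T> A C h t"
proof -
  have "Tmap \<T> A C (g \<circ> f) t = Tmap \<T> B C g (Tmap \<T> A B f t)"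
    by (rule T_functor_laws[THEN conjunct2, THEN conjunct2, THEN conjunct2, THEN conjunct2,
          rule_format]) (use assms in auto)
  moreover have "Tmap \<T> A C h t = Tmap \<T> A C (g \<circ> f) t"
    by (rule Tmap_cong) (use assms in \<open>auto simp: Pi_iff\<close>)
  ultimately show ?thesis by simp
qed

lemma unit_in: "small A \<Longrightarrow> x \<in> A \<Longrightarrow> Tunit \<T> A x \<in> Tobj \<T> A"
  by (rule funcset_mem[OF monad_laws[THEN conjunct2, THEN conjunct1, rule_format]])

lemma mult_in: "small A \<Longrightarrow> t \<in> Tobj \<T> (Tobj \<T> A) \<Longrightarrow> Tmult \<T> A t \<in> Tobj \<T> A"
  by (rule funcset_mem[OF monad_laws[THEN conjunct2, THEN conjunct2, THEN conjunct1, rule_format]])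

lemma unit_natural:
  "small A \<Longrightarrow> small B \<Longrightarrow> f \<in> A \<rightarrow> B \<Longrightarrow> x \<in> A \<Longrightarrow>
    Tmap \<T> A B f (Tunit \<T> A x) = Tunit \<T> B (f x)"
  by (rule monad_laws[THEN conjunct2, THEN conjunct2, THEN conjunct2, THEN conjunct1, rule_format])
    auto

lemma mult_natural:
  "small A \<Longrightarrow> small B \<Longrightarrow> f \<in> A \<rightarrow> B \<Longrightarrow> t \<in> Tobj \<T> (Tobj \<T> A) \<Longrightarrow>
    Tmap \<T> A B f (Tmult \<T> A t) = Tmult \<T> B (Tmap \<T> (Tobj \<T> A) (Tobj \<T> B) (Tmap \<T> A B f) t)"
  by (rule monad_laws[THEN conjunct2, THEN conjunct2, THEN conjunct2, THEN conjunct2,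
        THEN conjunct1, rule_format]) auto

lemma mult_unit: "small A \<Longrightarrow> t \<in> Tobj \<T> A \<Longrightarrow> Tmult \<T> A (Tunit \<T> (Tobj \<T> A) t) = t"
  by (rule monad_laws[THEN conjunct2, THEN conjunct2, THEN conjunct2, THEN conjunct2,
        THEN conjunct2, THEN conjunct1, rule_format])

lemma T_weak_pullback_lift:
  assumes "weak_pullback P A B C p q f g" and "s \<in> Tobj \<T> A" "t \<in> Tobj \<T> B"
    and "Tmap \<T> A C f s = Tmap \<T> B C g t"
  shows "\<exists>w\<in>Tobj \<T> P. Tmap \<T> P A p w = s \<and> Tmap \<T> P B q w = t"
proof (rule weak_pullback_lift)
  have "preserves_weak_pullbacks \<T>"
    using topological_theory by (simp add: topological_theory_def)
  then show "weak_pullback (Tobj \<T> P) (Tobj \<T> A) (Tobj \<T> B) (Tobj \<T> C)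
      (Tmap \<T> P A p) (Tmap \<T> P B q) (Tmap \<T> A C f) (Tmap \<T> B C g)"
    using assms(1) unfolding preserves_weak_pullbacks_def by blast
qed (use assms in auto)

lemma quant_in [simp]: "quant \<T> v \<in> Vset \<T>"
  by (simp add: Vset_def)

lemma Vval_quant [simp]: "Vval \<T> (quant \<T> v) = v"
  by (simp add: Vval_def inj_quant)

lemma quant_Vval [simp]: "u \<in> Vset \<T> \<Longrightarrow> quant \<T> (Vval \<T> u) = u"
  by (auto simp: Vset_def)

lemma xiT_cong:
  "small X \<Longrightarrow> (\<And>x. x \<in> X \<Longrightarrow> \<phi> x = \<psi> x) \<Longrightarrow> t \<in> Tobj \<T> X \<Longrightarrow> xiT \<T> X \<phi> t = xiT \<T> X \<psi> t"
  unfolding xiT_def by (rule arg_cong[of _ _ "xi \<T>"], rule Tmap_cong) (auto simp: small_V)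

lemma xiT_Tmap:
  assumes "small X" "small Y" "f \<in> X \<rightarrow> Y" "t \<in> Tobj \<T> X"
    and "\<And>x. x \<in> X \<Longrightarrow> \<psi> x = \<phi> (f x)"
  shows "xiT \<T> Y \<phi> (Tmap \<T> X Y f t) = xiT \<T> X \<psi> t"
  unfolding xiT_def using assms small_V
  by (intro arg_cong[of _ _ "xi \<T>"] Tmap_comp) auto

lemma xiT_unit:
  assumes "small X" "x \<in> X" shows "xiT \<T> X \<phi> (Tunit \<T> X x) = \<phi> x"
proof -
  have "Tmap \<T> X (Vset \<T>) (\<lambda>x. quant \<T> (\<phi> x)) (Tunit \<T> X x) = Tunit \<T> (Vset \<T>) (quant \<T> (\<phi> x))"
    using assms small_V by (intro unit_natural) auto
  then show ?thesis
    using topological_theory by (simp add: xiT_def topological_theory_def)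
qed

lemma xiT_mult:
  assumes X: "small X" and W: "W \<in> Tobj \<T> (Tobj \<T> X)"
  shows "xiT \<T> X \<phi> (Tmult \<T> X W) = xiT \<T> (Tobj \<T> X) (xiT \<T> X \<phi>) W"
proof -
  let ?V = "Vset \<T>" and ?g = "Tmap \<T> X (Vset \<T>) (\<lambda>x. quant \<T> (\<phi> x))"
  have g: "?g \<in> Tobj \<T> X \<rightarrow> Tobj \<T> ?V" using X small_V by (auto intro!: Tmap_in)
  let ?W = "Tmap \<T> (Tobj \<T> X) (Tobj \<T> ?V) ?g W"
  have W': "?W \<in> Tobj \<T> (Tobj \<T> ?V)"
    using g X W small_V by (intro Tmap_in small_T) auto
  have "xiT \<T> X \<phi> (Tmult \<T> X W) = xi \<T> (Tmult \<T> ?V ?W)"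
    unfolding xiT_def using X W small_V by (subst mult_natural) auto
  also have "\<dots> = xiT \<T> (Tobj \<T> ?V) (xi \<T>) ?W"
    using topological_theory W' by (simp add: topological_theory_def)
  also have "\<dots> = xiT \<T> (Tobj \<T> X) (xiT \<T> X \<phi>) W"
    using g X W small_V by (intro xiT_Tmap small_T) (auto simp: xiT_def)
  finally show ?thesis .
qed

lemma xiT_times:
  assumes X: "small X" and t: "t \<in> Tobj \<T> X"
  shows "xiT \<T> X (\<lambda>x. \<phi> x * \<psi> x) t = xiT \<T> X \<phi> t * xiT \<T> X \<psi> t"
proof -
  let ?V = "Vset \<T>"
  let ?P = "utimes ?V ?V" and ?c = "\<lambda>x. upair (quant \<T> (\<phi> x)) (quant \<T> (\<psi> x))"
  have P: "small ?P" by (simp add: small_utimes small_V)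
  let ?w = "Tmap \<T> X ?P ?c t"
  have w: "?w \<in> Tobj \<T> ?P" using X P t by (intro Tmap_in) auto
  have "xiT \<T> X (\<lambda>x. \<phi> x * \<psi> x) t = xiT \<T> ?P (\<lambda>p. Vval \<T> (ufst p) * Vval \<T> (usnd p)) ?w"
    using X P t by (intro xiT_Tmap[symmetric]) auto
  also have "\<dots> = xi \<T> (Tmap \<T> ?P ?V ufst ?w) * xi \<T> (Tmap \<T> ?P ?V usnd ?w)"
    using topological_theory w by (simp add: topological_theory_def)
  also have "Tmap \<T> ?P ?V ufst ?w = Tmap \<T> X ?V (\<lambda>x. quant \<T> (\<phi> x)) t"
    using X P t small_V by (intro Tmap_comp) (auto simp: ufst_in)
  also have "Tmap \<T> ?P ?V usnd ?w = Tmap \<T> X ?V (\<lambda>x. quant \<T> (\<psi> x)) t"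
    using X P t small_V by (intro Tmap_comp) (auto simp: usnd_in)
  finally show ?thesis by (simp add: xiT_def)
qed

lemma xiT_SUP:
  assumes "small X" "small Y" "f \<in> X \<rightarrow> Y" "t \<in> Tobj \<T> Y"
    and \<psi>: "\<And>y. y \<in> Y \<Longrightarrow> \<psi> y = (SUP x\<in>{x \<in> X. f x = y}. \<phi> x)"
  shows "xiT \<T> Y \<psi> t = (SUP s\<in>{s \<in> Tobj \<T> X. Tmap \<T> X Y f s = t}. xiT \<T> X \<phi> s)"
proof -
  have "\<forall>X Y f (\<phi> :: 'u \<Rightarrow> 'v). small X \<and> small Y \<and> f \<in> X \<rightarrow> Y \<longrightarrow>
        (\<forall>t\<in>Tobj \<T> Y. xiT \<T> Y (\<lambda>y. SUP x\<in>{x \<in> X. f x = y}. \<phi> x) t =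
           (SUP s\<in>{s \<in> Tobj \<T> X. Tmap \<T> X Y f s = t}. xiT \<T> X \<phi> s))"
    using topological_theory unfolding topological_theory_def by blast
  moreover have "xiT \<T> Y \<psi> t = xiT \<T> Y (\<lambda>y. SUP x\<in>{x \<in> X. f x = y}. \<phi> x) t"
    using assms by (intro xiT_cong) auto
  ultimately show ?thesis using assms by simp
qed

text \<open>
  Monotonicity is a consequence of the compatibility with \<open>f\<^sub>!\<close>. The set \<open>W\<close> of pairs \<open>(x, u)\<close>
  with \<open>u \<le> \<psi> x\<close> has \<open>\<psi>\<close> as the direct image of its second projection along the first, and \<open>\<phi>\<close>
  gives a section of the first projection.
\<close>

lemma xiT_mono:
  assumes X: "small X" and t: "t \<in> Tobj \<T> X" and le: "\<And>x. x \<in> X \<Longrightarrow> \<phi> x \<le> \<psi> x"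
  shows "xiT \<T> X \<phi> t \<le> xiT \<T> X \<psi> t"
proof -
  define W where "W = {p \<in> utimes X (Vset \<T>). Vval \<T> (usnd p) \<le> \<psi> (ufst p)}"
  have W: "small W"
    by (rule small_subset[OF small_utimes[OF X small_V]]) (auto simp: W_def)
  have f: "ufst \<in> W \<rightarrow> X" by (auto simp: W_def ufst_in)
  let ?i = "\<lambda>x. upair x (quant \<T> (\<phi> x))"
  have i: "?i \<in> X \<rightarrow> W" using le by (auto simp: W_def)
  let ?s = "Tmap \<T> X W ?i t"
  have s: "?s \<in> Tobj \<T> W" by (rule Tmap_in[OF X W i t])
  have "Tmap \<T> W X ufst ?s = Tmap \<T> X X (\<lambda>x. x) t"
    by (rule Tmap_comp[OF X W X i f t]) simp
  then have fs: "Tmap \<T> W X ufst ?s = t" using X t by (simp add: Tmap_id)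
  have "\<psi> x = (SUP p\<in>{p \<in> W. ufst p = x}. Vval \<T> (usnd p))" if "x \<in> X" for x
  proof (rule antisym)
    have "upair x (quant \<T> (\<psi> x)) \<in> {p \<in> W. ufst p = x}" using that by (simp add: W_def)
    then show "\<psi> x \<le> (SUP p\<in>{p \<in> W. ufst p = x}. Vval \<T> (usnd p))"
      by (rule SUP_upper2) simp
  qed (auto intro!: SUP_least simp: W_def)
  then have "xiT \<T> X \<psi> t =
      (SUP s\<in>{s \<in> Tobj \<T> W. Tmap \<T> W X ufst s = t}. xiT \<T> W (\<lambda>p. Vval \<T> (usnd p)) s)"
    by (rule xiT_SUP[OF W X f t])
  also have "\<dots> \<ge> xiT \<T> W (\<lambda>p. Vval \<T> (usnd p)) ?s"
    by (rule SUP_upper) (simp add: s fs)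
  also have "xiT \<T> W (\<lambda>p. Vval \<T> (usnd p)) ?s = xiT \<T> X \<phi> t"
    by (rule xiT_Tmap[OF X W i t]) simp
  finally show ?thesis .
qed


section \<open>The extension of \<V>-relations\<close>

lemma Trel_upper:
  "w \<in> Tobj \<T> (utimes X Y) \<Longrightarrow>
    xiT \<T> (utimes X Y) (\<lambda>p. r (ufst p) (usnd p)) w \<le>
      Trel \<T> X Y r (Tmap \<T> (utimes X Y) X ufst w) (Tmap \<T> (utimes X Y) Y usnd w)"
  unfolding Trel_def by (rule SUP_upper) simp

lemma Trel_mono:
  assumes "small X" "small Y" and le: "\<And>x y. x \<in> X \<Longrightarrow> y \<in> Y \<Longrightarrow> r x y \<le> s x y"
  shows "Trel \<T> X Y r \<xx> \<yy> \<le> Trel \<T> X Y s \<xx> \<yy>"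
  unfolding Trel_def
  by (rule SUP_subset_mono[OF order_refl], rule xiT_mono)
    (simp_all add: assms small_utimes ufst_in usnd_in)

text \<open>
  The pairing \<open>Z \<rightarrow> X \<times> Y\<close> of \<open>f\<close> and \<open>g\<close> carries \<open>t\<close> to a witness in \<open>T (X \<times> Y)\<close>. Lower bounds on
  the extension arise in this way from maps with values in a product.
\<close>

lemma Trel_span:
  assumes "small X" "small Y" "small Z" "f \<in> Z \<rightarrow> X" "g \<in> Z \<rightarrow> Y" "t \<in> Tobj \<T> Z"
    and le: "\<And>z. z \<in> Z \<Longrightarrow> \<phi> z \<le> r (f z) (g z)"
  shows "xiT \<T> Z \<phi> t \<le> Trel \<T> X Y r (Tmap \<T> Z X f t) (Tmap \<T> Z Y g t)"
proof -
  let ?P = "utimes X Y" and ?c = "\<lambda>z. upair (f z) (g z)"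
  have P: "small ?P" using assms by (simp add: small_utimes)
  have c: "?c \<in> Z \<rightarrow> ?P" using assms by auto
  let ?w = "Tmap \<T> Z ?P ?c t"
  have w: "?w \<in> Tobj \<T> ?P" using assms P c by (intro Tmap_in)
  have "xiT \<T> Z \<phi> t \<le> xiT \<T> Z (\<lambda>z. r (f z) (g z)) t"
    using assms by (intro xiT_mono) auto
  also have "\<dots> = xiT \<T> ?P (\<lambda>p. r (ufst p) (usnd p)) ?w"
    using assms P c by (intro xiT_Tmap[symmetric]) auto
  also have "\<dots> \<le> Trel \<T> X Y r (Tmap \<T> ?P X ufst ?w) (Tmap \<T> ?P Y usnd ?w)"
    by (rule Trel_upper[OF w])
  also have "Tmap \<T> ?P X ufst ?w = Tmap \<T> Z X f t"
    using assms P c by (intro Tmap_comp) (auto simp: ufst_in)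
  also have "Tmap \<T> ?P Y usnd ?w = Tmap \<T> Z Y g t"
    using assms P c by (intro Tmap_comp) (auto simp: usnd_in)
  finally show ?thesis .
qed

text \<open>
  The triple product \<open>X \<times> Y \<times> Z\<close> is the pullback of \<open>X \<times> Y\<close> and \<open>Y \<times> Z\<close> over \<open>Y\<close>. As \<open>T\<close> preserves
  it weakly, two witnesses for the factors with the same component in \<open>T Y\<close> come from a common
  element of \<open>T (X \<times> Y \<times> Z)\<close>.
\<close>

lemma Trel_comp_le:
  assumes X: "small X" and Y: "small Y" and Z: "small Z"
  shows "Trel \<T> X Y r \<xx> \<yy> * Trel \<T> Y Z s \<yy> \<zz> \<le> Trel \<T> X Z (rcomp Y s r) \<xx> \<zz>"
proof -
  let ?P = "utimes X Y" and ?Q = "utimes Y Z" and ?R = "utimes X (utimes Y Z)"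
  let ?p = "\<lambda>u. upair (ufst u) (ufst (usnd u))"
  have P: "small ?P" and Q: "small ?Q" and R: "small ?R"
    using X Y Z by (simp_all add: small_utimes)
  have wp: "weak_pullback ?R ?P ?Q Y ?p usnd usnd ufst"
  proof (rule weak_pullbackI[OF R P Q Y])
    fix v w assume "v \<in> ?P" "w \<in> ?Q" "usnd v = ufst w"
    then obtain x y z where "v = upair x y" "w = upair y z" "x \<in> X" "y \<in> Y" "z \<in> Z"
      by (auto elim!: utimesE)
    then show "\<exists>u\<in>?R. ?p u = v \<and> usnd u = w"
      by (intro bexI[of _ "upair x (upair y z)"]) auto
  qed (auto elim!: utimesE)
  have "xiT \<T> ?P (\<lambda>p. r (ufst p) (usnd p)) v * xiT \<T> ?Q (\<lambda>p. s (ufst p) (usnd p)) w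
      \<le> Trel \<T> X Z (rcomp Y s r) \<xx> \<zz>"
    if v: "v \<in> Tobj \<T> ?P" "Tmap \<T> ?P X ufst v = \<xx>" "Tmap \<T> ?P Y usnd v = \<yy>"
      and w: "w \<in> Tobj \<T> ?Q" "Tmap \<T> ?Q Y ufst w = \<yy>" "Tmap \<T> ?Q Z usnd w = \<zz>" for v w
  proof -
    obtain u where u: "u \<in> Tobj \<T> ?R" "Tmap \<T> ?R ?P ?p u = v" "Tmap \<T> ?R ?Q usnd u = w"
      using T_weak_pullback_lift[OF wp v(1) w(1)] v w by auto
    have p: "?p \<in> ?R \<rightarrow> ?P" and q: "usnd \<in> ?R \<rightarrow> ?Q" by (auto elim!: utimesE)
    have "xiT \<T> ?P (\<lambda>p. r (ufst p) (usnd p)) v = xiT \<T> ?R (\<lambda>u. r (ufst u) (ufst (usnd u))) u"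
      unfolding u(2)[symmetric] by (rule xiT_Tmap[OF R P p u(1)]) simp
    moreover have "xiT \<T> ?Q (\<lambda>p. s (ufst p) (usnd p)) w =
        xiT \<T> ?R (\<lambda>u. s (ufst (usnd u)) (usnd (usnd u))) u"
      unfolding u(3)[symmetric] by (rule xiT_Tmap[OF R Q q u(1)]) simp
    ultimately have "xiT \<T> ?P (\<lambda>p. r (ufst p) (usnd p)) v * xiT \<T> ?Q (\<lambda>p. s (ufst p) (usnd p)) w =
        xiT \<T> ?R (\<lambda>u. r (ufst u) (ufst (usnd u)) * s (ufst (usnd u)) (usnd (usnd u))) u"
      by (simp add: xiT_times[OF R u(1)])
    also have "\<dots> \<le> Trel \<T> X Z (rcomp Y s r) (Tmap \<T> ?R X ufst u)
        (Tmap \<T> ?R Z (\<lambda>u. usnd (usnd u)) u)"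
      by (rule Trel_span[OF X Z R _ _ u(1)])
        (auto elim!: utimesE intro!: rcomp_upper)
    also have "Tmap \<T> ?R X ufst u = \<xx>"
      unfolding v(2)[symmetric] u(2)[symmetric]
      by (rule Tmap_comp[OF R P X p _ u(1), symmetric]) (auto simp: ufst_in)
    also have "Tmap \<T> ?R Z (\<lambda>u. usnd (usnd u)) u = \<zz>"
      unfolding w(3)[symmetric] u(3)[symmetric]
      by (rule Tmap_comp[OF R Q Z q _ u(1), symmetric]) (auto simp: usnd_in)
    finally show ?thesis .
  qed
  then show ?thesis
    unfolding Trel_def[of \<T> X Y] Trel_def[of \<T> Y Z] quantale_SUP_mult quantale_mult_SUP
    by (intro SUP_least) auto
qed

text \<open>
  As a map on \<open>X \<times> Z\<close>, the composite \<open>s \<cdot> r\<close> is the direct image of \<open>r (x, y) \<otimes> s (y, z)\<close> along the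
  projection from \<open>X \<times> Y \<times> Z\<close>. Compatibility of \<open>\<xi>\<close> with direct images turns its extension into a
  supremum over \<open>T (X \<times> Y \<times> Z)\<close>, and each element there has a component in \<open>T Y\<close>.
\<close>

lemma Trel_comp_ge:
  assumes X: "small X" and Y: "small Y" and Z: "small Z"
  shows "Trel \<T> X Z (rcomp Y s r) \<xx> \<zz> \<le> rcomp (Tobj \<T> Y) (Trel \<T> Y Z s) (Trel \<T> X Y r) \<xx> \<zz>"
  unfolding Trel_def[of \<T> X Z]
proof (rule SUP_least, clarify)
  let ?P = "utimes X Z" and ?R = "utimes X (utimes Y Z)"
  let ?p = "\<lambda>u. upair (ufst u) (usnd (usnd u))" and ?y = "\<lambda>u. ufst (usnd u)"
  let ?rs = "rcomp (Tobj \<T> Y) (Trel \<T> Y Z s) (Trel \<T> X Y r)"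
  let ?r = "\<lambda>u. r (ufst u) (ufst (usnd u))" and ?s = "\<lambda>u. s (ufst (usnd u)) (usnd (usnd u))"
  have P: "small ?P" and R: "small ?R" using X Y Z by (simp_all add: small_utimes)
  have p: "?p \<in> ?R \<rightarrow> ?P" and x: "ufst \<in> ?R \<rightarrow> X" and y: "?y \<in> ?R \<rightarrow> Y"
    and z: "(\<lambda>u. usnd (usnd u)) \<in> ?R \<rightarrow> Z" by (auto elim!: utimesE)
  fix w assume w: "w \<in> Tobj \<T> ?P"
  have "rcomp Y s r (ufst v) (usnd v) = (SUP u\<in>{u \<in> ?R. ?p u = v}. ?r u * ?s u)"
    if v: "v \<in> ?P" for v
  proof (rule antisym)
    show "rcomp Y s r (ufst v) (usnd v) \<le> (SUP u\<in>{u \<in> ?R. ?p u = v}. ?r u * ?s u)"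
    proof (rule rcomp_leI)
      fix y assume "y \<in> Y"
      then have "upair (ufst v) (upair y (usnd v)) \<in> {u \<in> ?R. ?p u = v}"
        using v by (auto elim!: utimesE)
      then show "r (ufst v) y * s y (usnd v) \<le> (SUP u\<in>{u \<in> ?R. ?p u = v}. ?r u * ?s u)"
        by (rule SUP_upper2) simp
    qed
  qed (auto intro!: SUP_least rcomp_upper elim!: utimesE)
  then have "xiT \<T> ?P (\<lambda>p. rcomp Y s r (ufst p) (usnd p)) w =
      (SUP u\<in>{u \<in> Tobj \<T> ?R. Tmap \<T> ?R ?P ?p u = w}. xiT \<T> ?R (\<lambda>u. ?r u * ?s u) u)"
    by (rule xiT_SUP[OF R P p w])
  also have "\<dots> \<le> ?rs (Tmap \<T> ?P X ufst w) (Tmap \<T> ?P Z usnd w)"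
  proof (rule SUP_least, clarify)
    fix u assume u: "u \<in> Tobj \<T> ?R"
    let ?\<xx> = "Tmap \<T> ?R X ufst u" and ?\<yy> = "Tmap \<T> ?R Y ?y u"
      and ?\<zz> = "Tmap \<T> ?R Z (\<lambda>u. usnd (usnd u)) u"
    have 1: "Tmap \<T> ?P X ufst (Tmap \<T> ?R ?P ?p u) = ?\<xx>"
      by (rule Tmap_comp[OF R P X p _ u]) (auto simp: ufst_in)
    have 2: "Tmap \<T> ?P Z usnd (Tmap \<T> ?R ?P ?p u) = ?\<zz>"
      by (rule Tmap_comp[OF R P Z p _ u]) (auto simp: usnd_in)
    have "xiT \<T> ?R (\<lambda>u. ?r u * ?s u) u = xiT \<T> ?R ?r u * xiT \<T> ?R ?s u"
      by (rule xiT_times[OF R u])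
    also have "\<dots> \<le> Trel \<T> X Y r ?\<xx> ?\<yy> * Trel \<T> Y Z s ?\<yy> ?\<zz>"
      by (intro quantale_mult_mono2 Trel_span[OF X Y R x y u] Trel_span[OF Y Z R y z u]) simp_all
    also have "\<dots> \<le> ?rs ?\<xx> ?\<zz>"
      by (rule rcomp_upper) (rule Tmap_in[OF R Y y u])
    finally show "xiT \<T> ?R (\<lambda>u. ?r u * ?s u) u
        \<le> ?rs (Tmap \<T> ?P X ufst (Tmap \<T> ?R ?P ?p u)) (Tmap \<T> ?P Z usnd (Tmap \<T> ?R ?P ?p u))"
      by (simp add: 1 2)
  qed
  finally show "xiT \<T> ?P (\<lambda>p. rcomp Y s r (ufst p) (usnd p)) w
      \<le> ?rs (Tmap \<T> ?P X ufst w) (Tmap \<T> ?P Z usnd w)" .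
qed

text \<open>
  The extension of \<open>r\<close> is the direct image of \<open>\<xi> \<cdot> T r\<close> along \<open>T (X \<times> Y) \<rightarrow> T X \<times> T Y\<close>, so its own
  extension is computed by \<open>\<xi> \<cdot> T (\<xi> \<cdot> T r) = \<xi> \<cdot> T r \<cdot> m\<close> on \<open>T T (X \<times> Y)\<close>.
\<close>

lemma Trel_mult:
  assumes X: "small X" and Y: "small Y"
  shows "Trel \<T> (Tobj \<T> X) (Tobj \<T> Y) (Trel \<T> X Y r) \<XX> \<YY>
    \<le> Trel \<T> X Y r (Tmult \<T> X \<XX>) (Tmult \<T> Y \<YY>)"
  unfolding Trel_def[of \<T> "Tobj \<T> X"]
proof (rule SUP_least, clarify)
  let ?P = "utimes X Y" and ?Q = "utimes (Tobj \<T> X) (Tobj \<T> Y)"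
  let ?r = "\<lambda>p. r (ufst p) (usnd p)"
  let ?f = "Tmap \<T> ?P X ufst" and ?g = "Tmap \<T> ?P Y usnd"
  let ?c = "\<lambda>w. upair (?f w) (?g w)"
  have P: "small ?P" using X Y by (simp add: small_utimes)
  have TX: "small (Tobj \<T> X)" and TY: "small (Tobj \<T> Y)" and TP: "small (Tobj \<T> ?P)"
    using X Y P by (simp_all add: small_T)
  have Q: "small ?Q" using TX TY by (simp add: small_utimes)
  have fst: "ufst \<in> ?P \<rightarrow> X" and snd: "usnd \<in> ?P \<rightarrow> Y" by (auto simp: ufst_in usnd_in)
  have f: "?f \<in> Tobj \<T> ?P \<rightarrow> Tobj \<T> X" and g: "?g \<in> Tobj \<T> ?P \<rightarrow> Tobj \<T> Y"
    using Tmap_in[OF P X fst] Tmap_in[OF P Y snd] by auto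
  have c: "?c \<in> Tobj \<T> ?P \<rightarrow> ?Q" using f g by auto
  fix W assume W: "W \<in> Tobj \<T> ?Q"
  have "Trel \<T> X Y r (ufst v) (usnd v) = (SUP w\<in>{w \<in> Tobj \<T> ?P. ?c w = v}. xiT \<T> ?P ?r w)"
    if "v \<in> ?Q" for v
    using that unfolding Trel_def by (elim utimesE) (auto simp: upair_inject intro!: SUP_cong)
  then have "xiT \<T> ?Q (\<lambda>p. Trel \<T> X Y r (ufst p) (usnd p)) W =
      (SUP S\<in>{S \<in> Tobj \<T> (Tobj \<T> ?P). Tmap \<T> (Tobj \<T> ?P) ?Q ?c S = W}.
        xiT \<T> (Tobj \<T> ?P) (xiT \<T> ?P ?r) S)"
    by (rule xiT_SUP[OF TP Q c W])
  also have "\<dots> \<le> Trel \<T> X Y r (Tmult \<T> X (Tmap \<T> ?Q (Tobj \<T> X) ufst W))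
      (Tmult \<T> Y (Tmap \<T> ?Q (Tobj \<T> Y) usnd W))"
  proof (rule SUP_least, clarify)
    fix S assume S: "S \<in> Tobj \<T> (Tobj \<T> ?P)"
    let ?W = "Tmap \<T> (Tobj \<T> ?P) ?Q ?c S"
    have "Tmap \<T> ?Q (Tobj \<T> X) ufst ?W = Tmap \<T> (Tobj \<T> ?P) (Tobj \<T> X) ?f S"
      by (rule Tmap_comp[OF TP Q TX c _ S]) (auto simp: ufst_in)
    then have 1: "Tmult \<T> X (Tmap \<T> ?Q (Tobj \<T> X) ufst ?W) = ?f (Tmult \<T> ?P S)"
      by (simp add: mult_natural[OF P X fst S])
    have "Tmap \<T> ?Q (Tobj \<T> Y) usnd ?W = Tmap \<T> (Tobj \<T> ?P) (Tobj \<T> Y) ?g S"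
      by (rule Tmap_comp[OF TP Q TY c _ S]) (auto simp: usnd_in)
    then have 2: "Tmult \<T> Y (Tmap \<T> ?Q (Tobj \<T> Y) usnd ?W) = ?g (Tmult \<T> ?P S)"
      by (simp add: mult_natural[OF P Y snd S])
    show "xiT \<T> (Tobj \<T> ?P) (xiT \<T> ?P ?r) S \<le> Trel \<T> X Y r
        (Tmult \<T> X (Tmap \<T> ?Q (Tobj \<T> X) ufst ?W)) (Tmult \<T> Y (Tmap \<T> ?Q (Tobj \<T> Y) usnd ?W))"
      unfolding 1 2 xiT_mult[OF P S, symmetric]
      by (rule Trel_upper) (rule mult_in[OF P S])
  qed
  finally show "xiT \<T> ?Q (\<lambda>p. Trel \<T> X Y r (ufst p) (usnd p)) W
      \<le> Trel \<T> X Y r (Tmult \<T> X (Tmap \<T> ?Q (Tobj \<T> X) ufst W))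
          (Tmult \<T> Y (Tmap \<T> ?Q (Tobj \<T> Y) usnd W))" .
qed

end


section \<open>The evaluation relation of the exponential\<close>

locale exponential = top_theory \<T>
  for \<T> :: "('u::set_universe, 'v::comm_quantale) theory_data" (structure) +
  fixes X :: "'u set" and a :: "'u \<Rightarrow> 'u \<Rightarrow> 'v"
  assumes X_category: "t_category \<T> X a"
begin

abbreviation F :: "'u set" where "F \<equiv> Vexp \<T> X a"

definition \<mu> :: "'u \<Rightarrow> 'u \<Rightarrow> 'v" where
  "\<mu> = rcomp (Tobj \<T> X) a (Trel \<T> F X (Vev \<T>))"

lemma small_X: "small X"
  using X_category by (simp add: t_category_def t_graph_def)

lemma X_refl: "x \<in> X \<Longrightarrow> 1 \<le> a (Tunit \<T> X x) x"
  using X_category unit_in[OF small_X]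
  by (force simp: t_category_def t_graph_def rle_def rconv_def rmap_def)

lemma X_trans:
  assumes XX: "\<XX> \<in> Tobj \<T> (Tobj \<T> X)" and xx: "\<xx> \<in> Tobj \<T> X" and x: "x \<in> X"
  shows "Trel \<T> (Tobj \<T> X) X a \<XX> \<xx> * a \<xx> x \<le> a (Tmult \<T> X \<XX>) x"
proof -
  let ?m = "Tmult \<T> X \<XX>"
  let ?i = "rconv (rmap (Tmult \<T> X)) :: 'u \<Rightarrow> 'u \<Rightarrow> 'v"
  let ?s = "rcomp (Tobj \<T> (Tobj \<T> X)) (Trel \<T> (Tobj \<T> X) X a) ?i"
  have "Trel \<T> (Tobj \<T> X) X a \<XX> \<xx> = ?i ?m \<XX> * Trel \<T> (Tobj \<T> X) X a \<XX> \<xx>"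
    by (simp add: rconv_def rmap_def)
  also have "\<dots> \<le> ?s ?m \<xx>" by (rule rcomp_upper[OF XX])
  finally have "Trel \<T> (Tobj \<T> X) X a \<XX> \<xx> * a \<xx> x \<le> ?s ?m \<xx> * a \<xx> x"
    by (rule quantale_mult_mono2) simp
  also have "\<dots> \<le> rcomp (Tobj \<T> X) a ?s ?m x" by (rule rcomp_upper[OF xx])
  also have "\<dots> \<le> a ?m x"
    using X_category mult_in[OF small_X XX] x by (simp add: t_category_def rle_def)
  finally show ?thesis .
qed

lemma small_F: "small F"
  by (rule small_subset[OF small_functions[OF small_X small_V]])
    (auto simp: Vexp_def t_functor_def)

text \<open>
  By adjunction, a map \<open>\<phi>\<close> is a \<open>\<T>\<close>-functor to \<open>\<V>\<close> iff \<open>a (\<xx>, x) \<otimes> \<xi> \<cdot> T \<phi> (\<xx>) \<le> \<phi> x\<close>: it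
  carries an action of \<open>a\<close>. This form of functoriality is the one that \<open>\<mu>\<close> can be tested against.
\<close>

lemma Vexp_point:
  assumes h: "h \<in> F" and xx: "\<xx> \<in> Tobj \<T> X" and x: "x \<in> X"
  shows "a \<xx> x * xiT \<T> X (Vev \<T> h) \<xx> \<le> Vev \<T> h x"
proof -
  obtain f where h: "h = ulam X f" and f: "t_functor \<T> X a (Vset \<T>) (Vstr \<T>) f"
    using h by (auto simp: Vexp_def)
  have fV: "f \<in> X \<rightarrow> Vset \<T>" using f by (simp add: t_functor_def)
  have ev: "Vev \<T> h y = Vval \<T> (f y)" if "y \<in> X" for y
    using that by (simp add: Vev_def h uapp_ulam small_X)
  have "xiT \<T> X (Vev \<T> h) \<xx> = xi \<T> (Tmap \<T> X (Vset \<T>) f \<xx>)"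
    unfolding xiT_def using fV by (intro arg_cong[of _ _ "xi \<T>"] Tmap_cong small_X small_V xx)
      (auto simp: ev Pi_iff)
  then show ?thesis
    using f xx x by (auto simp: t_functor_def Vstr_def le_qhom_iff ev)
qed

lemma Vexp_of_map:
  assumes le: "\<And>\<xx> x. \<xx> \<in> Tobj \<T> X \<Longrightarrow> x \<in> X \<Longrightarrow> a \<xx> x * xiT \<T> X \<phi> \<xx> \<le> \<phi> x"
  shows "ulam X (\<lambda>x. quant \<T> (\<phi> x)) \<in> F"
proof -
  have "t_functor \<T> X a (Vset \<T>) (Vstr \<T>) (\<lambda>x. quant \<T> (\<phi> x))"
    using le by (auto simp: t_functor_def Vstr_def le_qhom_iff xiT_def)
  then show ?thesis by (auto simp: Vexp_def)
qed

lemma Vev_ulam: "x \<in> X \<Longrightarrow> Vev \<T> (ulam X (\<lambda>x. quant \<T> (\<phi> x))) x = \<phi> x"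
  by (simp add: Vev_def uapp_ulam small_X)

lemma le_Vexp_str:
  "c \<le> Vexp_str \<T> X a \<pp> h \<longleftrightarrow> (\<forall>x\<in>X. c * \<mu> \<pp> x \<le> Vev \<T> h x)"
proof -
  let ?P = "utimes F X" and ?ev = "\<lambda>p. Vev \<T> (ufst p) (usnd p)"
  have P: "small ?P" using small_F small_X by (simp add: small_utimes)
  have snd: "Tmap \<T> ?P X usnd \<qq> \<in> Tobj \<T> X" if "\<qq> \<in> Tobj \<T> ?P" for \<qq>
    by (rule Tmap_in[OF P small_X _ that]) (auto simp: usnd_in)
  have "c \<le> Vexp_str \<T> X a \<pp> h \<longleftrightarrow> (\<forall>x\<in>X. \<forall>\<qq>\<in>Tobj \<T> ?P. Tmap \<T> ?P F ufst \<qq> = \<pp> \<longrightarrow>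
      c * a (Tmap \<T> ?P X usnd \<qq>) x * xiT \<T> ?P ?ev \<qq> \<le> Vev \<T> h x)"
    by (auto simp: Vexp_str_def Let_def le_INF_iff le_qhom_iff)
  also have "\<dots> \<longleftrightarrow> (\<forall>x\<in>X. c * \<mu> \<pp> x \<le> Vev \<T> h x)"
    unfolding \<mu>_def rcomp_def Trel_def quantale_SUP_mult quantale_mult_SUP SUP_le_iff
    using snd by (auto simp: mult_ac)
  finally show ?thesis .
qed

text \<open>
  This is \<open>a \<cdot> T\<^sub>\<xi> \<mu> \<le> \<mu> \<cdot> m\<close>. One application of \<open>a\<close> is already built into \<open>\<mu>\<close>, and a second one
  can be merged with it because \<open>a\<close> is transitive.
\<close>

lemma \<mu>_closed:
  assumes PP: "\<PP> \<in> Tobj \<T> (Tobj \<T> F)" and xx: "\<xx> \<in> Tobj \<T> X" and x: "x \<in> X"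
  shows "Trel \<T> (Tobj \<T> F) X \<mu> \<PP> \<xx> * a \<xx> x \<le> \<mu> (Tmult \<T> F \<PP>) x"
proof -
  let ?E = "Trel \<T> F X (Vev \<T>)"
  let ?EE = "Trel \<T> (Tobj \<T> F) (Tobj \<T> X) ?E"
  have "Trel \<T> (Tobj \<T> F) X \<mu> \<PP> \<xx> * a \<xx> x
      \<le> rcomp (Tobj \<T> (Tobj \<T> X)) (Trel \<T> (Tobj \<T> X) X a) ?EE \<PP> \<xx> * a \<xx> x"
    unfolding \<mu>_def by (intro quantale_mult_mono2 Trel_comp_ge small_T small_F small_X order_refl)
  also have "\<dots> \<le> \<mu> (Tmult \<T> F \<PP>) x"
    unfolding rcomp_def quantale_SUP_mult
  proof (rule SUP_least)
    fix \<XX> assume XX: "\<XX> \<in> Tobj \<T> (Tobj \<T> X)"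
    have "?EE \<PP> \<XX> * Trel \<T> (Tobj \<T> X) X a \<XX> \<xx> * a \<xx> x
        \<le> ?E (Tmult \<T> F \<PP>) (Tmult \<T> X \<XX>) * a (Tmult \<T> X \<XX>) x"
      unfolding mult.assoc
      by (intro quantale_mult_mono2 Trel_mult X_trans small_F small_X XX xx x)
    also have "\<dots> \<le> \<mu> (Tmult \<T> F \<PP>) x"
      unfolding \<mu>_def by (rule rcomp_upper) (rule mult_in[OF small_X XX])
    finally show "?EE \<PP> \<XX> * Trel \<T> (Tobj \<T> X) X a \<XX> \<xx> * a \<xx> x \<le> \<mu> (Tmult \<T> F \<PP>) x" .
  qed
  finally show ?thesis .
qed

text \<open>The unit of \<open>T (\<V>\<^sup>X \<times> X)\<close> at \<open>(h, x)\<close> is a witness for the bound, as \<open>a\<close> is reflexive.\<close>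

lemma \<mu>_unit_ge:
  assumes h: "h \<in> F" and x: "x \<in> X"
  shows "Vev \<T> h x \<le> \<mu> (Tunit \<T> F h) x"
proof -
  have c: "(\<lambda>_. h) \<in> X \<rightarrow> F" and i: "(\<lambda>x. x) \<in> X \<rightarrow> X" using h by auto
  have "Vev \<T> h x = xiT \<T> X (Vev \<T> h) (Tunit \<T> X x)"
    by (simp add: xiT_unit[OF small_X x])
  also have "\<dots> \<le> Trel \<T> F X (Vev \<T>) (Tmap \<T> X F (\<lambda>_. h) (Tunit \<T> X x))
      (Tmap \<T> X X (\<lambda>x. x) (Tunit \<T> X x))"
    by (rule Trel_span[OF small_F small_X small_X c i unit_in[OF small_X x]]) simp
  also have "\<dots> = Trel \<T> F X (Vev \<T>) (Tunit \<T> F h) (Tunit \<T> X x)"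
    by (simp add: unit_natural[OF small_X small_F c x] unit_natural[OF small_X small_X i x])
  finally have "Vev \<T> h x * 1 \<le> Trel \<T> F X (Vev \<T>) (Tunit \<T> F h) (Tunit \<T> X x) * a (Tunit \<T> X x) x"
    by (rule quantale_mult_mono2) (rule X_refl[OF x])
  also have "\<dots> \<le> \<mu> (Tunit \<T> F h) x"
    unfolding \<mu>_def by (rule rcomp_upper) (rule unit_in[OF small_X x])
  finally show ?thesis by simp
qed

text \<open>
  The fibre \<open>{h} \<times> X\<close> is a pullback of \<open>h : 1 \<rightarrow> \<V>\<^sup>X\<close>, so every \<open>\<qq>\<close> over the unit at \<open>h\<close>
  comes from some \<open>\<xx> \<in> T X\<close>, and there the inequality is the functoriality of \<open>h\<close>.
\<close>

lemma \<mu>_unit_le: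
  assumes h: "h \<in> F" and x: "x \<in> X"
  shows "\<mu> (Tunit \<T> F h) x \<le> Vev \<T> h x"
proof -
  let ?P = "utimes F X" and ?i = "\<lambda>x. upair h x" and ?ev = "\<lambda>p. Vev \<T> (ufst p) (usnd p)"
  have P: "small ?P" using small_F small_X by (simp add: small_utimes)
  have i: "?i \<in> X \<rightarrow> ?P" and c: "(\<lambda>_. h) \<in> uone \<rightarrow> F" using h by auto
  have o: "uset {} \<in> uone" by (simp add: uone_def)
  have wp: "weak_pullback X ?P uone F ?i (\<lambda>_. uset {}) ufst (\<lambda>_. h)"
    by (rule weak_pullbackI[OF small_X P small_uone small_F i _ _ c])
      (auto elim!: utimesE simp: uone_def)
  have "xiT \<T> ?P ?ev \<qq> * a (Tmap \<T> ?P X usnd \<qq>) x \<le> Vev \<T> h x"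
    if q: "\<qq> \<in> Tobj \<T> ?P" "Tmap \<T> ?P F ufst \<qq> = Tunit \<T> F h" for \<qq>
  proof -
    have "Tmap \<T> ?P F ufst \<qq> = Tmap \<T> uone F (\<lambda>_. h) (Tunit \<T> uone (uset {}))"
      by (simp add: q unit_natural[OF small_uone small_F c o])
    then obtain \<xx> where xx: "\<xx> \<in> Tobj \<T> X" "Tmap \<T> X ?P ?i \<xx> = \<qq>"
      using T_weak_pullback_lift[OF wp q(1) unit_in[OF small_uone o]] by auto
    have "Tmap \<T> ?P X usnd \<qq> = Tmap \<T> X X (\<lambda>x. x) \<xx>"
      unfolding xx(2)[symmetric]
      by (rule Tmap_comp[OF small_X P small_X i _ xx(1)]) (auto simp: usnd_in)
    then have 1: "Tmap \<T> ?P X usnd \<qq> = \<xx>" by (simp add: Tmap_id[OF small_X _ xx(1)])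
    have "xiT \<T> ?P ?ev \<qq> = xiT \<T> X (Vev \<T> h) \<xx>"
      unfolding xx(2)[symmetric] by (rule xiT_Tmap[OF small_X P i xx(1)]) simp
    then show ?thesis using Vexp_point[OF h xx(1) x] by (simp add: 1 mult.commute)
  qed
  then show ?thesis
    unfolding \<mu>_def rcomp_def Trel_def quantale_SUP_mult by (intro SUP_least) auto
qed

lemma \<mu>_unit: "h \<in> F \<Longrightarrow> x \<in> X \<Longrightarrow> \<mu> (Tunit \<T> F h) x = Vev \<T> h x"
  by (intro antisym \<mu>_unit_le \<mu>_unit_ge)

end


section \<open>The dual of the exponential\<close>

locale exponential_T1 = exponential \<T> X a
  for \<T> :: "('u::set_universe, 'v::comm_quantale) theory_data" (structure)
    and X :: "'u set" and a :: "'u \<Rightarrow> 'u \<Rightarrow> 'v" +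
  assumes T1: "is_singleton (Tobj \<T> uone)"
begin

text \<open>A constant map factors through \<open>1\<close>, and the only element of \<open>T 1\<close> is a unit.\<close>

lemma Tmap_const:
  assumes A: "small A" and B: "small B" and b: "b \<in> B" and t: "t \<in> Tobj \<T> A"
  shows "Tmap \<T> A B (\<lambda>_. b) t = Tunit \<T> B b"
proof -
  have o: "uset {} \<in> uone" by (simp add: uone_def)
  have c: "(\<lambda>_. b) \<in> uone \<rightarrow> B" and d: "(\<lambda>_. uset {}) \<in> A \<rightarrow> uone" using b o by auto
  have "Tmap \<T> A uone (\<lambda>_. uset {}) t = Tunit \<T> uone (uset {})"
    using T1 Tmap_in[OF A small_uone d t] unit_in[OF small_uone o] by (auto simp: is_singleton_def)
  then have "Tmap \<T> A B (\<lambda>_. b) t = Tmap \<T> uone B (\<lambda>_. b) (Tunit \<T> uone (uset {}))"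
    using Tmap_comp[OF A small_uone B d c t] by simp
  then show ?thesis by (simp add: unit_natural[OF small_uone B c o])
qed

definition \<alpha> :: "'u \<Rightarrow> 'u" where
  "\<alpha> \<pp> = ulam X (\<lambda>x. quant \<T> (\<mu> \<pp> x))"

text \<open>
  Since \<open>T\<close> of the constant map at \<open>\<pp>\<close> sends all of \<open>T X\<close> to the unit of \<open>\<pp>\<close>, the value
  \<open>\<xi> \<cdot> T (\<mu> (\<pp>, -)) (\<xx>)\<close> is bounded by the extension of \<open>\<mu>\<close> at \<open>(e \<pp>, \<xx>)\<close>, and \<open>m (e \<pp>) = \<pp>\<close>.
\<close>

lemma \<alpha>_in:
  assumes p: "\<pp> \<in> Tobj \<T> F" shows "\<alpha> \<pp> \<in> F"
  unfolding \<alpha>_def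
proof (rule Vexp_of_map)
  fix \<xx> x assume xx: "\<xx> \<in> Tobj \<T> X" and x: "x \<in> X"
  have TF: "small (Tobj \<T> F)" by (rule small_T[OF small_F])
  have "xiT \<T> X (\<mu> \<pp>) \<xx> \<le> Trel \<T> (Tobj \<T> F) X \<mu> (Tmap \<T> X (Tobj \<T> F) (\<lambda>_. \<pp>) \<xx>)
      (Tmap \<T> X X (\<lambda>x. x) \<xx>)"
    by (rule Trel_span[OF TF small_X small_X _ _ xx]) (auto simp: p)
  also have "\<dots> = Trel \<T> (Tobj \<T> F) X \<mu> (Tunit \<T> (Tobj \<T> F) \<pp>) \<xx>"
    by (simp add: Tmap_const[OF small_X TF p xx] Tmap_id[OF small_X _ xx])
  finally have "xiT \<T> X (\<mu> \<pp>) \<xx> * a \<xx> x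
      \<le> Trel \<T> (Tobj \<T> F) X \<mu> (Tunit \<T> (Tobj \<T> F) \<pp>) \<xx> * a \<xx> x"
    by (rule quantale_mult_mono2) simp
  also have "\<dots> \<le> \<mu> (Tmult \<T> F (Tunit \<T> (Tobj \<T> F) \<pp>)) x"
    by (rule \<mu>_closed[OF unit_in[OF TF p] xx x])
  finally show "a \<xx> x * xiT \<T> X (\<mu> \<pp>) \<xx> \<le> \<mu> \<pp> x"
    by (simp add: mult_unit[OF small_F p] mult.commute)
qed

lemma Vev_\<alpha>: "x \<in> X \<Longrightarrow> Vev \<T> (\<alpha> \<pp>) x = \<mu> \<pp> x"
  by (simp add: \<alpha>_def Vev_ulam)

abbreviation d :: "'u \<Rightarrow> 'u \<Rightarrow> 'v" where "d \<equiv> Vexp_str \<T> X a"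

lemma le_underlying:
  assumes "g \<in> F"
  shows "c \<le> underlying \<T> F d g h \<longleftrightarrow> (\<forall>x\<in>X. c * Vev \<T> g x \<le> Vev \<T> h x)"
  using assms unit_in[OF small_F assms]
  by (simp add: underlying_def rcomp_rmap le_Vexp_str \<mu>_unit)

lemma represents_\<alpha>: "represents \<T> F d \<alpha>"
  unfolding represents_def
proof (intro conjI ballI)
  fix \<pp> h assume p: "\<pp> \<in> Tobj \<T> F" and "h \<in> F"
  have "c \<le> d \<pp> h \<longleftrightarrow> c \<le> underlying \<T> F d (\<alpha> \<pp>) h" for c
    by (simp add: le_underlying \<alpha>_in[OF p] le_Vexp_str Vev_\<alpha>)
  then show "d \<pp> h = rcomp F (underlying \<T> F d) (rmap \<alpha>) \<pp> h"
    by (simp add: rcomp_rmap \<alpha>_in[OF p] order_eq_iff)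
qed (auto simp: \<alpha>_in)

lemma underlying_trans:
  assumes "f \<in> F" "g \<in> F" "h \<in> F"
  shows "underlying \<T> F d f g * underlying \<T> F d g h \<le> underlying \<T> F d f h"
  unfolding le_underlying[OF assms(1)]
proof
  fix x assume x: "x \<in> X"
  have "underlying \<T> F d f g * Vev \<T> f x \<le> Vev \<T> g x"
    and gh: "underlying \<T> F d g h * Vev \<T> g x \<le> Vev \<T> h x"
    using le_underlying assms x by blast+
  then have "underlying \<T> F d g h * (underlying \<T> F d f g * Vev \<T> f x)
      \<le> underlying \<T> F d g h * Vev \<T> g x"
    by (intro quantale_mult_mono)
  also note gh
  finally show "underlying \<T> F d f g * underlying \<T> F d g h * Vev \<T> f x \<le> Vev \<T> h x"
    by (simp add: mult_ac)
qed

lemma Vexp_graphI: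
  fixes b :: "'u \<Rightarrow> 'u \<Rightarrow> 'v"
  assumes "\<And>h. h \<in> F \<Longrightarrow> 1 \<le> b (Tunit \<T> F h) h"
  shows "t_graph \<T> F b"
  using assms small_F by (auto simp: t_graph_def rle_def rconv_def rmap_def)

lemma dualisable: "dualisable \<T> F d"
  unfolding dualisable_def
proof (intro conjI)
  show "t_graph \<T> F d" by (rule Vexp_graphI) (simp add: le_Vexp_str \<mu>_unit)
  show "rle F F (rcomp F (underlying \<T> F d) (underlying \<T> F d)) (underlying \<T> F d)"
    unfolding rle_def by (intro ballI rcomp_leI underlying_trans)
  show "\<exists>\<alpha>. represents \<T> F d \<alpha>" using represents_\<alpha> by blast
qed

lemma le_dual:
  assumes p: "\<pp> \<in> Tobj \<T> F" and h: "h \<in> F"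
  shows "c \<le> dual \<T> F d \<pp> h \<longleftrightarrow> (\<forall>x\<in>X. c * Vev \<T> h x \<le> \<mu> \<pp> x)"
proof -
  have "dual \<T> F d \<pp> h = underlying \<T> F d h (\<alpha> \<pp>)"
    using dual_eq[OF monad dualisable represents_\<alpha> p h]
    by (simp add: rcomp_rmap \<alpha>_in[OF p] rconv_def)
  then show ?thesis by (simp add: le_underlying[OF h] Vev_\<alpha>)
qed

text \<open>
  After testing with \<open>h x\<close> the claim is \<open>\<mu> \<cdot> T\<^sub>\<xi> D \<le> \<mu> \<cdot> m\<close>, which follows by composing \<open>D\<close> with
  \<open>ev\<close> under \<open>T\<^sub>\<xi>\<close> and using that \<open>\<mu>\<close> is closed under \<open>a\<close>.
\<close>

lemma dual_trans:
  assumes PP: "\<PP> \<in> Tobj \<T> (Tobj \<T> F)" and p: "\<pp> \<in> Tobj \<T> F" and h: "h \<in> F"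
  shows "Trel \<T> (Tobj \<T> F) F (dual \<T> F d) \<PP> \<pp> * dual \<T> F d \<pp> h \<le> dual \<T> F d (Tmult \<T> F \<PP>) h"
  unfolding le_dual[OF mult_in[OF small_F PP] h]
proof
  let ?D = "dual \<T> F d"
  let ?TD = "Trel \<T> (Tobj \<T> F) F ?D"
  fix x assume x: "x \<in> X"
  have TF: "small (Tobj \<T> F)" by (rule small_T[OF small_F])
  have ev: "rcomp F (Vev \<T>) ?D \<qq> y \<le> \<mu> \<qq> y" if "\<qq> \<in> Tobj \<T> F" "y \<in> X" for \<qq> y
    using le_dual that by (intro rcomp_leI) blast
  have "?D \<pp> h * Vev \<T> h x \<le> \<mu> \<pp> x" using le_dual[OF p h] x by blast
  then have "?TD \<PP> \<pp> * ?D \<pp> h * Vev \<T> h x \<le> ?TD \<PP> \<pp> * \<mu> \<pp> x"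
    unfolding mult.assoc by (rule quantale_mult_mono)
  also have "\<dots> \<le> \<mu> (Tmult \<T> F \<PP>) x"
    unfolding \<mu>_def[THEN fun_cong, THEN fun_cong, of \<pp>] rcomp_def quantale_mult_SUP
  proof (rule SUP_least)
    fix \<xx> assume xx: "\<xx> \<in> Tobj \<T> X"
    have "?TD \<PP> \<pp> * Trel \<T> F X (Vev \<T>) \<pp> \<xx> \<le> Trel \<T> (Tobj \<T> F) X (rcomp F (Vev \<T>) ?D) \<PP> \<xx>"
      by (rule Trel_comp_le[OF TF small_F small_X])
    also have "\<dots> \<le> Trel \<T> (Tobj \<T> F) X \<mu> \<PP> \<xx>"
      by (rule Trel_mono[OF TF small_X ev])
    finally have "?TD \<PP> \<pp> * Trel \<T> F X (Vev \<T>) \<pp> \<xx> * a \<xx> x \<le> Trel \<T> (Tobj \<T> F) X \<mu> \<PP> \<xx> * a \<xx> x"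
      by (rule quantale_mult_mono2) simp
    also have "\<dots> \<le> \<mu> (Tmult \<T> F \<PP>) x" by (rule \<mu>_closed[OF PP xx x])
    finally show "?TD \<PP> \<pp> * (Trel \<T> F X (Vev \<T>) \<pp> \<xx> * a \<xx> x) \<le> \<mu> (Tmult \<T> F \<PP>) x"
      by (simp add: mult.assoc)
  qed
  finally show "?TD \<PP> \<pp> * ?D \<pp> h * Vev \<T> h x \<le> \<mu> (Tmult \<T> F \<PP>) x" .
qed

lemma dual_category: "t_category \<T> F (dual \<T> F d)"
  unfolding t_category_def
proof
  show "t_graph \<T> F (dual \<T> F d)"
    by (rule Vexp_graphI) (simp add: le_dual unit_in[OF small_F] \<mu>_unit)
  have bot: "(bot::'v) * v = bot" for v
    using mult_Sup[of v "{}"] by (simp add: mult.commute)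
  show "rle (Tobj \<T> F) F (rcomp (Tobj \<T> F) (dual \<T> F d)
      (rcomp (Tobj \<T> (Tobj \<T> F)) (Trel \<T> (Tobj \<T> F) F (dual \<T> F d)) (rconv (rmap (Tmult \<T> F)))))
      (dual \<T> F d)"
    unfolding rle_def
    by (intro ballI rcomp_leI, unfold rcomp_def[of "Tobj \<T> (Tobj \<T> F)"] quantale_SUP_mult,
        intro SUP_least) (auto simp: rconv_def rmap_def bot dual_trans)
qed

end

theorem proposition4p4:
  fixes \<T> :: "('u::set_universe, 'v::comm_quantale) theory_data"
    and X :: "'u set" and a :: "'u \<Rightarrow> 'u \<Rightarrow> 'v"
  assumes "topological_theory \<T>"
    and "(bot :: 'v) \<noteq> 1"
    and "is_singleton (Tobj \<T> uone)"
    and "t_category \<T> X a"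
  shows "t_category \<T> (Vexp \<T> X a) (dual \<T> (Vexp \<T> X a) (Vexp_str \<T> X a))"
proof -
  interpret exponential_T1 \<T> X a
    by unfold_locales (fact assms)+
  show ?thesis by (rule dual_category)
qed

end
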